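(* Under the standing assumptions on the law of $(A,B)$ listed in the context, let $\nu$ be the invariant Radon measure defined there, and let $L:[1,\infty)\to(0,\infty)$ be a slowly varying function such that, for some constants $0<a<b$ and $c>0$, $$L(t)\le\nu\big(\{x\in\mathbb R_+^d:|x|\in[ta,tb]\}\big)\le c\,L(t)\qquad\text{for all }t\ge1 .$$ Then $L$ is bounded.
   Context: Notation. Fix an integer $d\ge1$; $\mathbb R_+=[0,\infty)$; $|v|=\sum_{i=1}^d|\langle v,e_i\rangle|$ for $v\in\mathbb R^d$, with $(e_i)$ the standard basis. A $d\times d$ matrix with nonnegative entries is allowable if every row and every column has at least one strictly positive entry. $\mathbb M$ is the semigroup of allowable nonnegative $d\times d$ matrices and $\mathbb M_+\subset\mathbb M$ the subsemigroup of matrices with strictly positive entries. For $g\in\mathbb M_+$, $\lambda_g$ is its Perron–Frobenius eigenvalue (spectral radius). For $g\in\mathbb M$: $\|g\|=\sup_{v\in\mathbb R_+^d\setminus\{0\}}|gv|/|v|$, $\iota(g)=\inf_{v\in\mathbb R_+^d\setminus\{0\}}|gv|/|v|$, $N(g)=\max\{\iota(g)^{-1},\|g\|\}$. A positive measurable function $L$ is slowly varying (at infinity) if $\lim_{t\to\infty}L(ts)/L(t)=1$ for every $s>0$. Let $(A_n,B_n)_{n\ge1}$ be i.i.d. copies of a random pair $(A,B)$ with values in $\mathbb M\times\mathbb R_+^d$ (no independence between $A$ and $B$ is assumed). Let $\overline\mu$ be the law of $A$, $\operatorname{supp}\overline\mu$ its support in $\mathbb M$, and $\Gamma$ the smallest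 subsemigroup of $\mathbb M$ that contains $\operatorname{supp}\overline\mu$ and is closed in $\mathbb M$. Standing assumptions. (1) Every $g\in\Gamma$ is allowable and $\Gamma$ contains at least one matrix with strictly positive entries. (2) There is $\delta>0$ with $\mathbb E[N(A)^\delta]<\infty$, $\mathbb P(\iota(A)\ge1+\delta)>0$, $\mathbb E(|B|^\delta)<\infty$ and $\mathbb E(|B|^{-\delta})<\infty$. (3) The additive subgroup of $\mathbb R$ generated by $\{\log\lambda_g:g\in\Gamma\cap\mathbb M_+\}$ is dense in $\mathbb R$. (4) The Lyapunov exponent $\lambda=\lim_{n\to\infty}\frac1n\log\|A_n\cdots A_1\|$ (a.s. limit) equals $0$. (5) There is $\varkappa>1$ such that $\max_{i,j}g_{i,j}/\min_{i,j}g_{i,j}\le\varkappa$ for all $g\in\operatorname{supp}\overline\mu$ (in particular such $g$ have strictly positive entries). (6) There is no affine subspace $W\subset\mathbb R^d$ such that $W\cap\mathbb R_+^d$ contains a nonzero vector, is bounded, and is invariant under the action of all $g\in\operatorname{supp}\overline\mu$. Under these assumptions there is (known result) a nonzero Radon measure $\nu$ on $\mathbb R_+^d$, unique up to a positive multiplicative constant, which is invariant: $\nu(f)=\mathbb E\int_{\mathbb R_+^d}f(Ax+B)\,\nu(dx)$ for all bounded measurable compactly supported $f$ on $\mathbb R_+^d$; it has infinite total mass. Fix such a $\nu$. It is also known that a slowly varying function $L$ and constants as in the claim exist. *)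

theory Defs
  imports
    "HOL-Probability.Probability"
    "HOL-Computational_Algebra.Group_Closure"
begin

definition norm1 :: "real ^ 'n \<Rightarrow> real"
  where "norm1 v = (\<Sum>i\<in>UNIV. \<bar>v $ i\<bar>)"

definition nonneg_orthant :: "(real ^ 'n) set"
  where "nonneg_orthant = {v. \<forall>i. 0 \<le> v $ i}"

definition allowable :: "real ^ 'n ^ 'n \<Rightarrow> bool"
  where "allowable g \<longleftrightarrow>
    (\<forall>i j. 0 \<le> g $ i $ j) \<and> (\<forall>i. \<exists>j. 0 < g $ i $ j) \<and> (\<forall>j. \<exists>i. 0 < g $ i $ j)"

definition allowable_mats :: "(real ^ 'n ^ 'n) set"
  where "allowable_mats = {g. allowable g}"

definition positive_mats :: "(real ^ 'n ^ 'n) set"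
  where "positive_mats = {g. \<forall>i j. 0 < g $ i $ j}"

definition complex_eigenvalues :: "real ^ 'n ^ 'n \<Rightarrow> complex set"
  where "complex_eigenvalues g =
    {z. \<exists>v :: complex ^ 'n. v \<noteq> 0 \<and> map_matrix complex_of_real g *v v = z *s v}"

definition spectral_radius :: "real ^ 'n ^ 'n \<Rightarrow> real"
  where "spectral_radius g = Max (cmod ` complex_eigenvalues g)"

definition mat_norm :: "real ^ 'n ^ 'n \<Rightarrow> real"
  where "mat_norm g = (SUP v\<in>nonneg_orthant - {0}. norm1 (g *v v) / norm1 v)"

definition mat_iota :: "real ^ 'n ^ 'n \<Rightarrow> real"
  where "mat_iota g = (INF v\<in>nonneg_orthant - {0}. norm1 (g *v v) / norm1 v)"

text \<open>For allowable \<open>g\<close> one has \<open>mat_iota g > 0\<close>, so the convention \<open>inverse 0 = 0\<close> plays no role.\<close>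

definition mat_N :: "real ^ 'n ^ 'n \<Rightarrow> real"
  where "mat_N g = max (inverse (mat_iota g)) (mat_norm g)"

text \<open>\<open>left_prod X n = X n ** \<dots> ** X 1\<close>; the entry \<open>X 0\<close> is not used.\<close>

primrec left_prod :: "(nat \<Rightarrow> real ^ 'n ^ 'n) \<Rightarrow> nat \<Rightarrow> real ^ 'n ^ 'n"
  where
    "left_prod X 0 = mat 1"
  | "left_prod X (Suc n) = X (Suc n) ** left_prod X n"

text \<open>The support in the space of allowable matrices of a Borel measure on all matrices.\<close>

definition mat_support :: "(real ^ 'n ^ 'n) measure \<Rightarrow> (real ^ 'n ^ 'n) set"
  where "mat_support \<mu> = {g \<in> allowable_mats. \<forall>U. open U \<and> g \<in> U \<longrightarrow> 0 < emeasure \<mu> U}"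

definition closed_subsemigroup :: "(real ^ 'n ^ 'n) set \<Rightarrow> bool"
  where "closed_subsemigroup S \<longleftrightarrow>
    closedin (top_of_set allowable_mats) S \<and> (\<forall>g\<in>S. \<forall>h\<in>S. g ** h \<in> S)"

definition generated_semigroup :: "(real ^ 'n ^ 'n) set \<Rightarrow> (real ^ 'n ^ 'n) set"
  where "generated_semigroup T = \<Inter> {S. closed_subsemigroup S \<and> T \<subseteq> S}"

definition mat_entries :: "real ^ 'n ^ 'n \<Rightarrow> real set"
  where "mat_entries g = {g $ i $ j | i j. True}"

definition radon_measure_on :: "(real ^ 'n) set \<Rightarrow> (real ^ 'n) measure \<Rightarrow> bool"
  where "radon_measure_on S \<nu> \<longleftrightarrow>
    sets \<nu> = sets (restrict_space borel S) \<and>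
    (\<forall>K. compact K \<and> K \<subseteq> S \<longrightarrow> emeasure \<nu> K < \<infinity>) \<and>
    (\<forall>E\<in>sets \<nu>. emeasure \<nu> E = (SUP K\<in>{K. compact K \<and> K \<subseteq> E}. emeasure \<nu> K))"

definition bounded_compact_test :: "(real ^ 'n \<Rightarrow> real) \<Rightarrow> bool"
  where "bounded_compact_test f \<longleftrightarrow>
    f \<in> borel_measurable (restrict_space borel nonneg_orthant) \<and>
    bounded (f ` nonneg_orthant) \<and>
    (\<exists>K. compact K \<and> K \<subseteq> nonneg_orthant \<and> (\<forall>x\<in>nonneg_orthant - K. f x = 0))"

text \<open>The integrability clause expresses that the iterated integral is finite; without it, the
  equation would be distorted by the convention that the Bochner integral of a non-integrable
  function is \<open>0\<close>.  When \<open>A\<close> is allowable, the inner integrand is bounded with compact support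
  in the orthant, so the inner integral needs no such clause.\<close>

definition invariant_measure ::
  "'w measure \<Rightarrow> ('w \<Rightarrow> real ^ 'n ^ 'n) \<Rightarrow> ('w \<Rightarrow> real ^ 'n) \<Rightarrow> (real ^ 'n) measure \<Rightarrow> bool"
  where "invariant_measure P A B \<nu> \<longleftrightarrow>
    (\<forall>f. bounded_compact_test f \<longrightarrow>
      integrable P (\<lambda>\<omega>. \<integral>x. f (A \<omega> *v x + B \<omega>) \<partial>\<nu>) \<and>
      (\<integral>x. f x \<partial>\<nu>) = (\<integral>\<omega>. (\<integral>x. f (A \<omega> *v x + B \<omega>) \<partial>\<nu>) \<partial>P))"

text \<open>A function on \<open>[1, \<infinity>)\<close> is represented by a total function whose values below \<open>1\<close> are
  irrelevant.\<close>

definition slowly_varying :: "(real \<Rightarrow> real) \<Rightarrow> bool"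
  where "slowly_varying L \<longleftrightarrow>
    (\<forall>t\<ge>1. 0 < L t) \<and>
    L \<in> borel_measurable (restrict_space borel {1..}) \<and>
    (\<forall>s>0. ((\<lambda>t. L (t * s) / L t) \<longlongrightarrow> 1) at_top)"

end

theory Submission
  imports Defs
begin

text \<open>The argument is a conservation law. Suppose a function \<open>w\<close> on the orthant stays within a
constant of \<open>ln (1 + |x|)\<close> and has almost no upward drift along the recursion,
\<open>E w(Ax + B) \<le> w(x) + h(x)\<close> with \<open>h \<ge> 0\<close> and \<open>\<integral> h d\<nu> < \<infinity>\<close>. Test the invariance of \<open>\<nu>\<close> against
the tent \<open>f = (T - w)\<^sup>+\<close>, which is bounded with compact support. Since
\<open>(T - w)\<^sup>+ + w = T + (w - T)\<^sup>+\<close>, the drift inequality turns \<open>\<integral> (E f(Ax + B) - f) d\<nu> = 0\<close> into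
\<open>\<integral>\<^bsub>{w \<le> T}\<^esub> E (w(Ax + B) - T)\<^sup>+ d\<nu> \<le> \<integral> h d\<nu>\<close>, a bound on the overshoot above the level \<open>T\<close>
that does not depend on \<open>T\<close> (\<open>upward_flux_bound\<close>).

If the shell at distance about \<open>e\<^sup>T\<close> carried a large mass, a fixed proportion of it would be pushed
outwards by \<open>A\<close> with \<open>\<iota>(A) \<ge> 1 + \<delta>\<close> at each step. After a bounded number of such steps it must have
overshot one of a bounded number of levels near \<open>T\<close>. So the mass of the shell is bounded by a
constant times \<open>\<integral> h d\<nu>\<close> (\<open>band_measure_bounded\<close>), and so is \<open>L\<close>.

The function \<open>w\<close> is built from \<open>p\<^sub>n(x) = E ln |A\<^sub>n \<dots> A\<^sub>1 x|\<close>. Each \<open>p\<^sub>n\<close> is monotone and satisfies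
\<open>p\<^sub>n(t x) = ln t + p\<^sub>n(x)\<close>, and one matrix with entries comparable up to \<open>\<kappa>\<close> makes any two vectors of
the same norm comparable up to \<open>\<kappa>\<close>. Hence \<open>p\<^sub>n(x) - ln |x|\<close> oscillates by at most \<open>ln \<kappa>\<close> in \<open>x\<close>.
This makes \<open>n \<mapsto> p\<^sub>n - ln\<close> additive up to a constant, and a vanishing Lyapunov exponent then leaves
only \<open>|p\<^sub>n(x) - ln |x|| \<le> ln \<kappa>\<close> for all \<open>n\<close> (\<open>log_growth_bounded\<close>). By construction
\<open>E p\<^sub>n(A x) = p\<^bsub>n+1\<^esub>(x)\<close>, so by Fatou's lemma \<open>liminf p\<^sub>n\<close> is superharmonic for the linear action.
The translation by \<open>B\<close> costs at most \<open>ln (1 + \<kappa> |B| / |A x|)\<close>, by monotonicity and homogeneity again,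
and the expectation of this is \<open>O(|x|\<^sup>-\<^sup>\<epsilon>)\<close> (\<open>lyapunov_function\<close>).

Finally \<open>\<integral> (1 + |x|)\<^sup>-\<^sup>\<epsilon> d\<nu> < \<infinity>\<close> because a slowly varying \<open>L\<close> grows slower than any power
(\<open>norm1_powr_integrable\<close>).\<close>

section \<open>The sum norm and nonnegative matrices\<close>

definition colsum :: "real ^ 'n ^ 'n \<Rightarrow> 'n \<Rightarrow> real"
  where "colsum g j = (\<Sum>i\<in>UNIV. g $ i $ j)"

text \<open>A Borel function of the matrix that plays the role of \<open>N(g)\<close>: on allowable matrices it is bounded by
a constant multiple of \<open>mat_N\<close>, and it still controls \<open>|ln |g x| - ln |x||\<close>. Finite sums of column
sums make its measurability immediate, in contrast to a supremum over vectors.\<close>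

definition distortion :: "real ^ 'n ^ 'n \<Rightarrow> real"
  where "distortion g = (\<Sum>j\<in>UNIV. colsum g j + inverse (colsum g j))"

definition entries_comparable :: "real \<Rightarrow> real ^ 'n ^ 'n \<Rightarrow> bool"
  where "entries_comparable \<kappa> g \<longleftrightarrow> (\<forall>i j k l. 0 < g $ i $ j \<and> g $ i $ j \<le> \<kappa> * g $ k $ l)"

lemma norm1_nonneg [simp]: "0 \<le> norm1 x"
  by (simp add: norm1_def sum_nonneg)

lemma norm1_eq_0_iff [simp]: "norm1 x = 0 \<longleftrightarrow> x = 0"
  by (simp add: norm1_def sum_nonneg_eq_0_iff vec_eq_iff)

lemma norm1_zero [simp]: "norm1 0 = 0"
  by simp

lemma norm1_pos: "x \<noteq> 0 \<Longrightarrow> 0 < norm1 x"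
  using norm1_nonneg[of x] norm1_eq_0_iff[of x] by linarith

lemma norm1_scaleR: "norm1 (t *\<^sub>R x) = \<bar>t\<bar> * norm1 x"
  by (simp add: norm1_def abs_mult sum_distrib_left)

lemma norm1_orthant: "x \<in> nonneg_orthant \<Longrightarrow> norm1 x = (\<Sum>i\<in>UNIV. x $ i)"
  by (simp add: norm1_def nonneg_orthant_def)

lemma norm1_add_orthant:
  "x \<in> nonneg_orthant \<Longrightarrow> y \<in> nonneg_orthant \<Longrightarrow> norm1 (x + y) = norm1 x + norm1 y"
  by (simp add: norm1_def nonneg_orthant_def sum.distrib)

lemma norm1_mono_orthant: "x \<in> nonneg_orthant \<Longrightarrow> x \<le> y \<Longrightarrow> norm1 x \<le> norm1 y"
  unfolding norm1_def nonneg_orthant_def less_eq_vec_def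
  by (intro sum_mono) (smt (verit) mem_Collect_eq)

lemma continuous_on_norm1: "continuous_on S (norm1 :: real ^ 'n \<Rightarrow> real)"
  unfolding norm1_def by (intro continuous_intros)

lemma measurable_norm1 [measurable]: "(norm1 :: real ^ 'n \<Rightarrow> real) \<in> borel_measurable borel"
  by (intro borel_measurable_continuous_onI continuous_on_norm1)

lemma norm_le_norm1: "norm x \<le> norm1 x"
  unfolding norm1_def using norm_le_l1_cart by blast

lemma add_orthant: "x \<in> nonneg_orthant \<Longrightarrow> y \<in> nonneg_orthant \<Longrightarrow> x + y \<in> nonneg_orthant"
  by (simp add: nonneg_orthant_def)

lemma scaleR_orthant: "x \<in> nonneg_orthant \<Longrightarrow> 0 \<le> t \<Longrightarrow> t *\<^sub>R x \<in> nonneg_orthant"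
  by (simp add: nonneg_orthant_def)

lemma closed_orthant: "closed (nonneg_orthant :: (real ^ 'n) set)"
  unfolding nonneg_orthant_def
  by (intro closed_Collect_all closed_Collect_le continuous_intros)

lemma orthant_sets [measurable]: "(nonneg_orthant :: (real ^ 'n) set) \<in> sets borel"
  using closed_orthant by (rule borel_closed)

lemma compact_norm1_ball: "compact {x \<in> nonneg_orthant. norm1 (x :: real ^ 'n) \<le> r}"
proof -
  have "bounded {x \<in> nonneg_orthant. norm1 (x :: real ^ 'n) \<le> r}"
    by (rule boundedI[of _ r]) (use norm_le_norm1 order_trans in blast)
  moreover have "closed (nonneg_orthant \<inter> {x. norm1 (x :: real ^ 'n) \<le> r})"
    by (intro closed_Int closed_orthant closed_Collect_le continuous_on_norm1 continuous_intros)
  ultimately show ?thesis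
    by (simp add: compact_eq_bounded_closed Int_def)
qed

lemma measurable_matrix_vector_mult [measurable (raw)]:
  fixes g :: "'a \<Rightarrow> real ^ 'n ^ 'm"
  assumes "g \<in> borel_measurable M" "x \<in> borel_measurable M"
  shows "(\<lambda>\<omega>. g \<omega> *v x \<omega>) \<in> borel_measurable M"
proof -
  have "continuous_on UNIV (\<lambda>p :: (real ^ 'n ^ 'm) \<times> (real ^ 'n). fst p *v snd p)"
    unfolding matrix_vector_mult_def by (intro continuous_intros)
  then show ?thesis
    by (rule borel_measurable_continuous_Pair[OF assms])
qed

lemma measurable_matrix_mult [measurable (raw)]:
  fixes g :: "'a \<Rightarrow> real ^ 'n ^ 'm" and h :: "'a \<Rightarrow> real ^ 'k ^ 'n"
  assumes "g \<in> borel_measurable M" "h \<in> borel_measurable M"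
  shows "(\<lambda>\<omega>. g \<omega> ** h \<omega>) \<in> borel_measurable M"
proof -
  have "continuous_on UNIV (\<lambda>p :: (real ^ 'n ^ 'm) \<times> (real ^ 'k ^ 'n). fst p ** snd p)"
    unfolding matrix_matrix_mult_def by (intro continuous_intros)
  then show ?thesis
    by (rule borel_measurable_continuous_Pair[OF assms])
qed

lemma measurable_colsum [measurable]: "(\<lambda>g. colsum g j) \<in> borel_measurable borel"
  unfolding colsum_def by (intro borel_measurable_continuous_onI continuous_intros)

lemma measurable_distortion [measurable]: "distortion \<in> borel_measurable borel"
  unfolding distortion_def by measurable

definition nonneg_mats :: "(real ^ 'n ^ 'n) set"
  where "nonneg_mats = {g. \<forall>i j. 0 \<le> g $ i $ j}"

lemma mv_orthant:
  "g \<in> nonneg_mats \<Longrightarrow> x \<in> nonneg_orthant \<Longrightarrow> g *v x \<in> nonneg_orthant"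
  by (auto simp: nonneg_mats_def nonneg_orthant_def matrix_vector_mult_def intro!: sum_nonneg)

lemma norm1_mv:
  assumes "g \<in> nonneg_mats" "x \<in> nonneg_orthant"
  shows "norm1 (g *v x) = (\<Sum>j\<in>UNIV. colsum g j * x $ j)"
  by (subst norm1_orthant[OF mv_orthant[OF assms]])
    (simp add: matrix_vector_mult_def colsum_def sum_distrib_right, rule sum.swap)

lemma mv_mono:
  fixes g :: "real ^ 'n ^ 'n"
  assumes "g \<in> nonneg_mats" "x \<le> y"
  shows "g *v x \<le> g *v y"
  using assms by (auto simp: nonneg_mats_def less_eq_vec_def matrix_vector_mult_def
    intro!: sum_mono mult_left_mono)

lemma colsum_bounds_norm1:
  assumes g: "g \<in> nonneg_mats" and x: "x \<in> nonneg_orthant"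
    and lo: "\<And>j. l \<le> colsum g j" and up: "\<And>j. colsum g j \<le> u"
  shows "l * norm1 x \<le> norm1 (g *v x)" "norm1 (g *v x) \<le> u * norm1 x"
proof -
  have "0 \<le> x $ j" for j using x by (simp add: nonneg_orthant_def)
  then show "l * norm1 x \<le> norm1 (g *v x)" "norm1 (g *v x) \<le> u * norm1 x"
    unfolding norm1_mv[OF g x] norm1_orthant[OF x] sum_distrib_left
    using lo up by (auto intro!: sum_mono mult_right_mono)
qed

lemma colsum_axis: "g \<in> nonneg_mats \<Longrightarrow> norm1 (g *v axis j 1) = colsum g j"
  by (subst norm1_mv) (auto simp: nonneg_orthant_def axis_def if_distrib cong: if_cong)

lemma axis_orthant: "axis j (1::real) \<in> nonneg_orthant"
  by (auto simp: nonneg_orthant_def axis_def)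

lemma norm1_axis: "norm1 (axis j (1::real)) = 1"
  by (simp add: norm1_orthant[OF axis_orthant]) (simp add: axis_def)

lemma allowable_nonneg: "allowable g \<Longrightarrow> g \<in> nonneg_mats"
  by (simp add: allowable_def nonneg_mats_def)

lemma colsum_pos_allowable: "allowable g \<Longrightarrow> 0 < colsum g j"
  unfolding colsum_def allowable_def
  by (metis (no_types, lifting) finite iso_tuple_UNIV_I sum_pos2)

lemma distortion_terms:
  assumes "\<And>j. 0 < colsum g j"
  shows "colsum g j \<le> distortion g" "inverse (colsum g j) \<le> distortion g" "1 \<le> distortion g"
proof -
  have *: "colsum g j + inverse (colsum g j) \<le> distortion g"
    unfolding distortion_def
    using less_imp_le[OF assms] by (intro member_le_sum) auto
  with assms[of j] show "colsum g j \<le> distortion g" "inverse (colsum g j) \<le> distortion g"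
    by (smt (verit) positive_imp_inverse_positive)+
  show "1 \<le> distortion g"
  proof (cases "1 \<le> colsum g j")
    case True
    with \<open>colsum g j \<le> distortion g\<close> show ?thesis by simp
  next
    case False
    with assms[of j] have "1 \<le> inverse (colsum g j)" by (simp add: one_le_inverse)
    with \<open>inverse (colsum g j) \<le> distortion g\<close> show ?thesis by simp
  qed
qed

lemma norm1_mv_distortion:
  assumes g: "g \<in> nonneg_mats" and pos: "\<And>j. 0 < colsum g j" and x: "x \<in> nonneg_orthant"
  shows "norm1 (g *v x) \<le> distortion g * norm1 x" "norm1 x \<le> distortion g * norm1 (g *v x)"
proof -
  let ?D = "distortion g"
  have D: "1 \<le> ?D" by (rule distortion_terms(3)[OF pos])
  have "inverse ?D \<le> colsum g j" for j
    using le_imp_inverse_le[OF distortion_terms(2)[OF pos, where j=j]] pos[of j] by simp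
  note b = colsum_bounds_norm1[OF g x this distortion_terms(1)[OF pos]]
  show "norm1 (g *v x) \<le> ?D * norm1 x" by (rule b)
  show "norm1 x \<le> ?D * norm1 (g *v x)" using b(1) D by (simp add: field_simps)
qed

lemma ln_norm1_mv:
  assumes g: "g \<in> nonneg_mats" and pos: "\<And>j. 0 < colsum g j"
    and x: "x \<in> nonneg_orthant" "x \<noteq> 0"
  shows "g *v x \<noteq> 0" "\<bar>ln (norm1 (g *v x)) - ln (norm1 x)\<bar> \<le> ln (distortion g)"
proof -
  note b = norm1_mv_distortion[OF g pos x(1)]
  have D: "1 \<le> distortion g" by (rule distortion_terms(3)[OF pos])
  have nx: "0 < norm1 x" using x norm1_pos by blast
  with b(2) show nz: "g *v x \<noteq> 0" using norm1_eq_0_iff[of "g *v x"] by (auto simp: norm1_def)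
  have ng: "0 < norm1 (g *v x)" using nz norm1_pos by blast
  have "ln (norm1 (g *v x)) \<le> ln (distortion g * norm1 x)"
    using b(1) ng nx D by (subst ln_le_cancel_iff) auto
  moreover have "ln (norm1 x) \<le> ln (distortion g * norm1 (g *v x))"
    using b(2) ng nx D by (subst ln_le_cancel_iff) auto
  ultimately show "\<bar>ln (norm1 (g *v x)) - ln (norm1 x)\<bar> \<le> ln (distortion g)"
    using nz x nx ng D by (simp add: ln_mult)
qed

lemma mat_norm_bounds:
  fixes g :: "real ^ 'n ^ 'n"
  assumes g: "g \<in> nonneg_mats"
  shows "colsum g j \<le> mat_norm g" "mat_norm g \<le> (\<Sum>j\<in>UNIV. colsum g j)"
proof -
  let ?s = "\<Sum>j\<in>UNIV. colsum g j"
  have c0: "0 \<le> colsum g j" for j using g by (auto simp: colsum_def nonneg_mats_def intro: sum_nonneg)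
  have up: "norm1 (g *v v) / norm1 v \<le> ?s" if "v \<in> nonneg_orthant - {0}" for v
    using colsum_bounds_norm1(2)[OF g, of v 0 ?s] that c0 norm1_pos[of v]
    by (simp add: divide_le_eq member_le_sum)
  have bdd: "bdd_above ((\<lambda>v. norm1 (g *v v) / norm1 v) ` (nonneg_orthant - {0}))"
    using up by (intro bdd_aboveI[of _ ?s]) auto
  have ax: "axis j (1::real) \<in> nonneg_orthant - {0}"
    using axis_orthant by (simp add: axis_eq_0_iff)
  show "colsum g j \<le> mat_norm g"
    using cSUP_upper[OF ax bdd] by (simp add: mat_norm_def norm1_axis colsum_axis[OF g])
  show "mat_norm g \<le> ?s"
    unfolding mat_norm_def using ax by (intro cSUP_least up) auto
qed

lemma mat_iota_bounds:
  fixes g :: "real ^ 'n ^ 'n"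
  assumes al: "allowable g"
  shows "0 < mat_iota g" "mat_iota g \<le> colsum g j"
    "v \<in> nonneg_orthant \<Longrightarrow> mat_iota g * norm1 v \<le> norm1 (g *v v)"
proof -
  note g = allowable_nonneg[OF al]
  note pos = colsum_pos_allowable[OF al]
  have D: "1 \<le> distortion g" by (rule distortion_terms(3)[OF pos])
  have lo: "inverse (distortion g) \<le> norm1 (g *v v) / norm1 v" if "v \<in> nonneg_orthant - {0}" for v
    using norm1_mv_distortion(2)[OF g pos, of v] that D norm1_pos[of v] by (simp add: field_simps)
  have bdd: "bdd_below ((\<lambda>v. norm1 (g *v v) / norm1 v) ` (nonneg_orthant - {0}))"
    using lo by (intro bdd_belowI[of _ "inverse (distortion g)"]) auto
  have ax: "axis j (1::real) \<in> nonneg_orthant - {0}"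
    using axis_orthant by (simp add: axis_eq_0_iff)
  have "inverse (distortion g) \<le> mat_iota g"
    unfolding mat_iota_def using ax by (intro cINF_greatest lo) auto
  with D show "0 < mat_iota g"
    by (smt (verit) positive_imp_inverse_positive)
  show "mat_iota g \<le> colsum g j"
    using cINF_lower[OF bdd ax] by (simp add: mat_iota_def norm1_axis colsum_axis[OF g])
  show "mat_iota g * norm1 v \<le> norm1 (g *v v)" if v: "v \<in> nonneg_orthant"
  proof (cases "v = 0")
    case True then show ?thesis by (simp add: norm1_def)
  next
    case False
    with v cINF_lower[OF bdd, of v] norm1_pos[of v] show ?thesis
      by (simp add: mat_iota_def field_simps)
  qed
qed

lemma distortion_le_mat_N:
  fixes g :: "real ^ 'n ^ 'n"
  assumes al: "allowable g"
  shows "distortion g \<le> 2 * real CARD('n) * mat_N g"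
proof -
  have "colsum g j + inverse (colsum g j) \<le> 2 * mat_N g" for j
  proof -
    have "colsum g j \<le> mat_N g"
      using mat_norm_bounds(1)[OF allowable_nonneg[OF al], of j] by (simp add: mat_N_def)
    moreover have "inverse (colsum g j) \<le> mat_N g"
      unfolding mat_N_def
      by (rule max.coboundedI1) (rule le_imp_inverse_le[OF mat_iota_bounds(2,1)[OF al]])
    ultimately show ?thesis by simp
  qed
  then have "distortion g \<le> (\<Sum>j\<in>(UNIV :: 'n set). 2 * mat_N g)"
    unfolding distortion_def by (intro sum_mono)
  then show ?thesis by simp
qed

lemma comparable_nonneg: "entries_comparable \<kappa> g \<Longrightarrow> g \<in> nonneg_mats"
  by (auto simp: entries_comparable_def nonneg_mats_def intro: less_imp_le)

lemma comparable_colsum_pos: "entries_comparable \<kappa> g \<Longrightarrow> 0 < colsum g j"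
  by (auto simp: entries_comparable_def colsum_def intro: sum_pos)

text \<open>Each row of \<open>g\<close> weighs all coordinates alike up to \<open>\<kappa>\<close>, so it sees little more of a vector than its
norm. This coordinatewise comparison is the only consequence of comparable entries on which the
uniform estimates rest.\<close>

lemma comparable_mv_le:
  fixes g :: "real ^ 'n ^ 'n"
  assumes g: "entries_comparable \<kappa> g" and x: "x \<in> nonneg_orthant"
    and y: "y \<in> nonneg_orthant" "y \<noteq> 0"
  shows "g *v x \<le> (\<kappa> * norm1 x / norm1 y) *\<^sub>R (g *v y)"
proof -
  have ny: "0 < norm1 y" using y norm1_pos by blast
  have "(g *v x) $ i \<le> \<kappa> * norm1 x / norm1 y * (g *v y) $ i" for i
  proof -
    have "(g *v x) $ i * norm1 y = (\<Sum>j\<in>UNIV. \<Sum>k\<in>UNIV. g $ i $ j * (x $ j * y $ k))"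
      by (simp add: matrix_vector_mult_def norm1_orthant[OF y(1)] sum_product mult.assoc)
    also have "\<dots> \<le> (\<Sum>j\<in>UNIV. \<Sum>k\<in>UNIV. (\<kappa> * g $ i $ k) * (x $ j * y $ k))"
      using g x y unfolding entries_comparable_def nonneg_orthant_def
      by (intro sum_mono mult_right_mono) auto
    also have "\<dots> = (\<Sum>j\<in>UNIV. x $ j) * (\<kappa> * (\<Sum>k\<in>UNIV. g $ i $ k * y $ k))"
      by (subst sum.swap) (simp add: sum_distrib_left sum_distrib_right mult_ac)
    also have "\<dots> = \<kappa> * norm1 x * (g *v y) $ i"
      by (simp add: matrix_vector_mult_def norm1_orthant[OF x])
    finally show ?thesis using ny by (simp add: field_simps)
  qed
  then show ?thesis by (simp add: less_eq_vec_def)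
qed

section \<open>Mean logarithmic growth for matrices with comparable entries\<close>

abbreviation nonzero_orthant :: "(real ^ 'n) set"
  where "nonzero_orthant \<equiv> nonneg_orthant - {0}"

lemma nonzero_orthant_scaleR: "x \<in> nonzero_orthant \<Longrightarrow> 0 < t \<Longrightarrow> t *\<^sub>R x \<in> nonzero_orthant"
  by (auto simp: scaleR_orthant)

lemma nonzero_orthant_upward: "x \<in> nonzero_orthant \<Longrightarrow> x \<le> y \<Longrightarrow> y \<in> nonzero_orthant"
proof -
  assume x: "x \<in> nonzero_orthant" and le: "x \<le> y"
  have "y \<in> nonneg_orthant"
    using x le unfolding nonneg_orthant_def less_eq_vec_def by (auto intro: order_trans)
  moreover have "0 < norm1 y"
    using norm1_mono_orthant[of x y] norm1_pos[of x] x le by simp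
  ultimately show "y \<in> nonzero_orthant" by auto
qed

lemma nonzero_orthant_mv: "entries_comparable \<kappa> g \<Longrightarrow> x \<in> nonzero_orthant \<Longrightarrow> g *v x \<in> nonzero_orthant"
proof -
  assume g: "entries_comparable \<kappa> g" and x: "x \<in> nonzero_orthant"
  show "g *v x \<in> nonzero_orthant"
    using mv_orthant[OF comparable_nonneg[OF g], of x] x
      ln_norm1_mv(1)[OF comparable_nonneg[OF g] comparable_colsum_pos[OF g], of x] by simp
qed

locale comparable_matrix_law = prob_space \<mu> for \<mu> :: "(real ^ 'n ^ 'n) measure" +
  fixes \<kappa> :: real
  assumes sets_law [simp, measurable_cong]: "sets \<mu> = sets borel"
    and comparable: "AE g in \<mu>. entries_comparable \<kappa> g"
    and ln_distortion: "integrable \<mu> (\<lambda>g. ln (distortion g))"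
begin

text \<open>For an i.i.d. sequence with law \<open>\<mu>\<close>, \<open>log_growth n x\<close> is the expectation of \<open>ln |A\<^sub>n \<dots> A\<^sub>1 x|\<close>.
Iterating the transfer operator of \<open>\<mu>\<close> avoids any reference to such a sequence.\<close>

definition log_growth :: "nat \<Rightarrow> real ^ 'n \<Rightarrow> real"
  where "log_growth n = ((\<lambda>f x. \<integral>g. f (g *v x) \<partial>\<mu>) ^^ n) (\<lambda>x. ln (norm1 x))"

lemma log_growth_0 [simp]: "log_growth 0 x = ln (norm1 x)"
  by (simp add: log_growth_def)

lemma log_growth_Suc: "log_growth (Suc n) x = (\<integral>g. log_growth n (g *v x) \<partial>\<mu>)"
  by (simp add: log_growth_def)

lemma kappa_ge_1: "1 \<le> \<kappa>"
proof -
  obtain g :: "real ^ 'n ^ 'n" where "entries_comparable \<kappa> g"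
    using eventually_happens'[OF ae_filter_bot comparable] by blast
  then have "0 < g $ i $ i" "g $ i $ i \<le> \<kappa> * g $ i $ i" for i
    by (auto simp: entries_comparable_def)
  then show ?thesis by (metis mult_le_cancel_right1 not_less_iff_gr_or_eq)
qed

lemma measurable_log_growth [measurable]: "log_growth n \<in> borel_measurable borel"
proof (induction n)
  case 0
  have "(\<lambda>x :: real ^ 'n. ln (norm1 x)) \<in> borel_measurable borel" by measurable
  then show ?case by (simp add: log_growth_def)
next
  case (Suc n)
  note [measurable] = Suc
  show ?case unfolding log_growth_Suc by measurable
qed

lemma distortion_ge_1: "AE g in \<mu>. 1 \<le> distortion g"
  using comparable by eventually_elim (rule distortion_terms(3)[OF comparable_colsum_pos])

text \<open>The bound grows with \<open>n\<close> and serves only to make all the integrals exist; the uniform bound is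
\<open>log_growth_bounded\<close>.\<close>

lemma log_growth_crude:
  assumes x: "x \<in> nonzero_orthant"
  shows "\<bar>log_growth n x - ln (norm1 x)\<bar> \<le> real n * expectation (\<lambda>g. ln (distortion g))"
    and "integrable \<mu> (\<lambda>g. log_growth n (g *v x))"
proof -
  let ?d = "expectation (\<lambda>g. ln (distortion g))"
  have int: "integrable \<mu> (\<lambda>g. log_growth n (g *v x))"
      and bd: "AE g in \<mu>. \<bar>log_growth n (g *v x) - ln (norm1 x)\<bar> \<le> real n * ?d + ln (distortion g)"
    if x: "x \<in> nonzero_orthant" and IH: "\<And>y. y \<in> nonzero_orthant \<Longrightarrow> \<bar>log_growth n y - ln (norm1 y)\<bar> \<le> real n * ?d"
    for n x
  proof -
    show bd: "AE g in \<mu>. \<bar>log_growth n (g *v x) - ln (norm1 x)\<bar> \<le> real n * ?d + ln (distortion g)"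
      using comparable
    proof eventually_elim
      case (elim g)
      from ln_norm1_mv(2)[OF comparable_nonneg[OF elim] comparable_colsum_pos[OF elim], of x]
        IH[OF nonzero_orthant_mv[OF elim x]] x
      show ?case by simp
    qed
    show "integrable \<mu> (\<lambda>g. log_growth n (g *v x))"
    proof (rule Bochner_Integration.integrable_bound)
      show "integrable \<mu> (\<lambda>g. \<bar>ln (norm1 x)\<bar> + real n * ?d + ln (distortion g))"
        using ln_distortion by simp
      show "AE g in \<mu>. norm (log_growth n (g *v x))
          \<le> norm (\<bar>ln (norm1 x)\<bar> + real n * ?d + ln (distortion g))"
        using bd by eventually_elim simp
    qed measurable
  qed
  have crude: "\<bar>log_growth n x - ln (norm1 x)\<bar> \<le> real n * ?d" if "x \<in> nonzero_orthant" for n x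
    using that
  proof (induction n arbitrary: x)
    case (Suc n)
    note i = int[OF Suc.prems Suc.IH]
    have "\<bar>expectation (\<lambda>g. log_growth n (g *v x) - ln (norm1 x))\<bar>
        \<le> expectation (\<lambda>g. \<bar>log_growth n (g *v x) - ln (norm1 x)\<bar>)"
      by (rule integral_abs_bound)
    also have "\<dots> \<le> expectation (\<lambda>g. real n * ?d + ln (distortion g))"
      using i ln_distortion bd[OF Suc.prems Suc.IH] by (intro integral_mono_AE) auto
    finally have "\<bar>expectation (\<lambda>g. log_growth n (g *v x) - ln (norm1 x))\<bar>
        \<le> expectation (\<lambda>g. real n * ?d + ln (distortion g))" .
    then show ?case
      using i ln_distortion
      by (simp add: log_growth_Suc prob_space ring_distribs)
  qed simp
  show "\<bar>log_growth n x - ln (norm1 x)\<bar> \<le> real n * ?d" by (rule crude[OF x])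
  show "integrable \<mu> (\<lambda>g. log_growth n (g *v x))" by (rule int[OF x crude])
qed

text \<open>The induction step of all later comparisons: an inequality between values of \<open>log_growth\<close> survives
one more random factor on each side, and has to be checked only for factors with comparable entries.\<close>

lemma log_growth_step_mono:
  assumes x: "x \<in> nonzero_orthant" and y: "y \<in> nonzero_orthant"
    and le: "\<And>g. entries_comparable \<kappa> g \<Longrightarrow> log_growth m (g *v x) \<le> c + log_growth n (g *v y)"
  shows "log_growth (Suc m) x \<le> c + log_growth (Suc n) y"
proof -
  have "log_growth (Suc m) x \<le> expectation (\<lambda>g. c + log_growth n (g *v y))"
    unfolding log_growth_Suc using log_growth_crude(2)[OF x] log_growth_crude(2)[OF y] comparable le
    by (intro integral_mono_AE) auto
  then show ?thesis
    using log_growth_crude(2)[OF y] by (simp add: log_growth_Suc prob_space)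
qed

lemma log_growth_scaleR:
  assumes "0 < t" "x \<in> nonzero_orthant"
  shows "log_growth n (t *\<^sub>R x) = ln t + log_growth n x"
  using assms(2)
proof (induction n arbitrary: x)
  case 0
  with assms(1) show ?case
    by (simp add: norm1_scaleR ln_mult norm1_pos)
next
  case (Suc n)
  have s: "t *\<^sub>R x \<in> nonzero_orthant" by (rule nonzero_orthant_scaleR[OF Suc.prems assms(1)])
  have eq: "log_growth n (g *v (t *\<^sub>R x)) = ln t + log_growth n (g *v x)"
    if "entries_comparable \<kappa> g" for g
    using Suc.IH[OF nonzero_orthant_mv[OF that Suc.prems]] by (simp add: matrix_vector_mult_scaleR)
  have "log_growth (Suc n) (t *\<^sub>R x) \<le> ln t + log_growth (Suc n) x"
    by (rule log_growth_step_mono[OF s Suc.prems]) (simp add: eq)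
  moreover have "log_growth (Suc n) x \<le> - ln t + log_growth (Suc n) (t *\<^sub>R x)"
    by (rule log_growth_step_mono[OF Suc.prems s]) (simp add: eq)
  ultimately show ?case by simp
qed

lemma log_growth_mono:
  assumes "x \<in> nonzero_orthant" "x \<le> y"
  shows "log_growth n x \<le> log_growth n y"
  using assms
proof (induction n arbitrary: x y)
  case 0
  with nonzero_orthant_upward[OF 0] show ?case
    by (simp add: ln_le_cancel_iff norm1_pos norm1_mono_orthant)
next
  case (Suc n)
  have "log_growth (Suc n) x \<le> 0 + log_growth (Suc n) y"
    using Suc.prems nonzero_orthant_upward[OF Suc.prems]
    by (intro log_growth_step_mono)
      (auto intro!: Suc.IH simp: nonzero_orthant_mv[simplified] mv_mono[OF comparable_nonneg])
  then show ?case by simp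
qed

lemma log_growth_le_scaled:
  assumes "x \<in> nonzero_orthant" "y \<in> nonzero_orthant" "0 < t" "x \<le> t *\<^sub>R y"
  shows "log_growth n x \<le> ln t + log_growth n y"
  using log_growth_mono[OF assms(1,4)] log_growth_scaleR[OF assms(3,2)] by simp

text \<open>For \<open>n > 0\<close> the first matrix already makes \<open>x\<close> and \<open>y\<close> comparable, and the remaining steps preserve
a coordinatewise inequality.\<close>

lemma log_growth_oscillation:
  assumes x: "x \<in> nonzero_orthant" and y: "y \<in> nonzero_orthant"
  shows "log_growth n x - ln (norm1 x) \<le> ln \<kappa> + (log_growth n y - ln (norm1 y))"
proof (cases n)
  case 0
  then show ?thesis using kappa_ge_1 by simp
next
  case (Suc m)
  let ?t = "\<kappa> * norm1 x / norm1 y"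
  have pos: "0 < norm1 x" "0 < norm1 y" "0 < \<kappa>" using x y norm1_pos kappa_ge_1 by auto
  then have t: "0 < ?t" by simp
  have "log_growth (Suc m) x \<le> ln ?t + log_growth (Suc m) y"
    using x y by (intro log_growth_step_mono log_growth_le_scaled comparable_mv_le nonzero_orthant_mv t) auto
  also have "ln ?t = ln \<kappa> + ln (norm1 x) - ln (norm1 y)"
    using pos x y by (simp add: ln_mult ln_div)
  finally show ?thesis using Suc by simp
qed

text \<open>Monotonicity and homogeneity replace any regularity of \<open>log_growth n\<close>: after one step, \<open>b\<close> is
dominated by a multiple of \<open>y\<close>, so adding \<open>b\<close> amounts to rescaling \<open>y\<close>. The bound is uniform in \<open>n\<close>.\<close>

lemma log_growth_perturb:
  assumes y: "y \<in> nonzero_orthant" and b: "b \<in> nonneg_orthant"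
  shows "log_growth n (y + b) \<le> ln (1 + \<kappa> * norm1 b / norm1 y) + log_growth n y"
proof -
  let ?t = "\<kappa> * norm1 b / norm1 y"
  have pos: "0 < norm1 y" "0 < \<kappa>" using y norm1_pos kappa_ge_1 by auto
  then have t: "0 < 1 + ?t" by (smt (verit) divide_nonneg_pos mult_nonneg_nonneg norm1_nonneg)
  have yb: "y + b \<in> nonzero_orthant"
    by (rule nonzero_orthant_upward[OF y]) (use b in \<open>simp add: less_eq_vec_def nonneg_orthant_def\<close>)
  show ?thesis
  proof (cases n)
    case 0
    have "norm1 (y + b) = norm1 y + norm1 b" using y b norm1_add_orthant by blast
    also have "\<dots> \<le> (1 + ?t) * norm1 y"
      using pos y mult_right_mono[OF kappa_ge_1, of "norm1 b"] by (simp add: distrib_right)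
    finally have "ln (norm1 (y + b)) \<le> ln ((1 + ?t) * norm1 y)"
      using norm1_pos yb by (subst ln_le_cancel_iff) (use t pos in auto)
    also have "\<dots> = ln (1 + ?t) + ln (norm1 y)"
      using t pos by (subst ln_mult) auto
    finally show ?thesis using 0 by simp
  next
    case (Suc m)
    have "g *v (y + b) \<le> (1 + ?t) *\<^sub>R (g *v y)" if g: "entries_comparable \<kappa> g" for g
      using comparable_mv_le[OF g b, of y] y
      by (auto simp: matrix_vector_right_distrib scaleR_left_distrib less_eq_vec_def)
    then show ?thesis
      unfolding Suc using y yb
      by (intro log_growth_step_mono log_growth_le_scaled nonzero_orthant_mv t) auto
  qed
qed

text \<open>Since the transfer operator is monotone and commutes with adding constants, a uniform gain over
\<open>m\<close> steps accumulates linearly.\<close>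

lemma log_growth_superadditive:
  assumes "\<And>y. y \<in> nonzero_orthant \<Longrightarrow> ln (norm1 y) + c \<le> log_growth m y" "y \<in> nonzero_orthant"
  shows "ln (norm1 y) + real j * c \<le> log_growth (j * m) y"
proof -
  have *: "log_growth n y + c \<le> log_growth (n + m) y" if "y \<in> nonzero_orthant" for n y
    using that
  proof (induction n arbitrary: y)
    case 0
    then show ?case using assms(1) by simp
  next
    case (Suc n)
    have "log_growth (Suc n) y \<le> - c + log_growth (Suc (n + m)) y"
      using Suc.IH[OF nonzero_orthant_mv[OF _ Suc.prems]] Suc.prems
      by (intro log_growth_step_mono) (auto simp: algebra_simps)
    then show ?case by simp
  qed
  show ?thesis
  proof (induction j)
    case (Suc j)
    with *[OF assms(2), of "j * m"] show ?case by (simp add: algebra_simps)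
  qed simp
qed

lemma log_growth_subadditive:
  assumes "\<And>y. y \<in> nonzero_orthant \<Longrightarrow> log_growth m y \<le> ln (norm1 y) + c" "y \<in> nonzero_orthant"
  shows "log_growth (j * m) y \<le> ln (norm1 y) + real j * c"
proof -
  have *: "log_growth (n + m) y \<le> log_growth n y + c" if "y \<in> nonzero_orthant" for n y
    using that
  proof (induction n arbitrary: y)
    case 0
    then show ?case using assms(1) by simp
  next
    case (Suc n)
    have "log_growth (Suc (n + m)) y \<le> c + log_growth (Suc n) y"
      using Suc.IH[OF nonzero_orthant_mv[OF _ Suc.prems]] Suc.prems
      by (intro log_growth_step_mono) (auto simp: algebra_simps)
    then show ?case by simp
  qed
  show ?thesis
  proof (induction j)
    case (Suc j)
    with *[OF assms(2), of "j * m"] show ?case by (simp add: algebra_simps)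
  qed simp
qed

text \<open>If the mean growth over \<open>m\<close> steps exceeded \<open>ln \<kappa>\<close> for one starting vector, it would be bounded below by
a positive constant for all of them, because the oscillation is at most \<open>ln \<kappa>\<close>; then it would
accumulate to a positive exponential rate. The same holds for the other sign.\<close>

lemma log_growth_bounded:
  assumes u: "u \<in> nonzero_orthant" and lim: "(\<lambda>n. log_growth n u / real n) \<longlonglongrightarrow> 0"
    and x: "x \<in> nonzero_orthant"
  shows "\<bar>log_growth m x - ln (norm1 x)\<bar> \<le> ln \<kappa>"
proof (cases "m = 0")
  case True
  then show ?thesis using kappa_ge_1 by simp
next
  case False
  have sub: "(\<lambda>j. log_growth (Suc j * m) u / real (Suc j * m)) \<longlonglongrightarrow> 0"
    using LIMSEQ_subseq_LIMSEQ[OF lim, of "\<lambda>j. Suc j * m"] False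
    by (simp add: strict_mono_def o_def)
  have lin: "(\<lambda>j. (ln (norm1 u) + real (Suc j) * c) / real (Suc j * m)) \<longlonglongrightarrow> c / real m" for c
  proof -
    have "(\<lambda>j. ln (norm1 u) / real m * inverse (real (Suc j)) + c / real m)
        \<longlonglongrightarrow> ln (norm1 u) / real m * 0 + c / real m"
      by (intro tendsto_intros LIMSEQ_inverse_real_of_nat)
    moreover have "(\<lambda>j. ln (norm1 u) / real m * inverse (real (Suc j)) + c / real m)
        = (\<lambda>j. (ln (norm1 u) + real (Suc j) * c) / real (Suc j * m))"
    proof
      fix j
      have "real m \<noteq> 0" "real (Suc j) \<noteq> 0" using False by simp_all
      then show "ln (norm1 u) / real m * inverse (real (Suc j)) + c / real m
          = (ln (norm1 u) + real (Suc j) * c) / real (Suc j * m)"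
        unfolding of_nat_mult by (simp add: divide_simps del: of_nat_Suc)
    qed
    ultimately show ?thesis by simp
  qed
  let ?q = "log_growth m x - ln (norm1 x)"
  have "?q - ln \<kappa> \<le> 0"
  proof -
    have "ln (norm1 y) + (?q - ln \<kappa>) \<le> log_growth m y" if "y \<in> nonzero_orthant" for y
      using log_growth_oscillation[OF x that, of m] by simp
    note super = log_growth_superadditive[OF this u]
    have "(ln (norm1 u) + real (Suc j) * (?q - ln \<kappa>)) / real (Suc j * m)
        \<le> log_growth (Suc j * m) u / real (Suc j * m)" for j
      by (intro divide_right_mono super) auto
    then have "(?q - ln \<kappa>) / real m \<le> 0"
      by (intro LIMSEQ_le[OF lin sub]) auto
    with False show ?thesis by (simp add: field_simps)
  qed
  moreover have "0 \<le> ?q + ln \<kappa>"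
  proof -
    have "log_growth m y \<le> ln (norm1 y) + (?q + ln \<kappa>)" if "y \<in> nonzero_orthant" for y
      using log_growth_oscillation[OF that x, of m] by simp
    note sub_add = log_growth_subadditive[OF this u]
    have "log_growth (Suc j * m) u / real (Suc j * m)
        \<le> (ln (norm1 u) + real (Suc j) * (?q + ln \<kappa>)) / real (Suc j * m)" for j
      by (intro divide_right_mono sub_add) auto
    then have "0 \<le> (?q + ln \<kappa>) / real m"
      by (intro LIMSEQ_le[OF sub lin]) auto
    with False show ?thesis by (simp add: field_simps)
  qed
  ultimately show ?thesis by linarith
qed

end

section \<open>Products of independent matrices with vanishing Lyapunov exponent\<close>

text \<open>A bound on the second moments gives uniform integrability: \<open>|y| \<le> min |y| m + y\<^sup>2 / m\<close>, where the
first term is handled by dominated convergence and the second is small for large \<open>m\<close>.\<close>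

lemma (in prob_space) expectation_tendsto_0_of_bounded_square:
  fixes Y :: "nat \<Rightarrow> 'a \<Rightarrow> real"
  assumes meas [measurable]: "\<And>n. Y n \<in> borel_measurable M"
    and lim: "AE \<omega> in M. (\<lambda>n. Y n \<omega>) \<longlonglongrightarrow> 0"
    and int: "\<And>n. integrable M (\<lambda>\<omega>. (Y n \<omega>)\<^sup>2)"
    and bound: "\<And>n. expectation (\<lambda>\<omega>. (Y n \<omega>)\<^sup>2) \<le> C"
  shows "(\<lambda>n. expectation (Y n)) \<longlonglongrightarrow> 0"
proof (rule LIMSEQ_I)
  fix r :: real assume r: "0 < r"
  have C0: "0 \<le> C" by (rule order_trans[OF _ bound[of 0]]) simp
  define m where "m = 2 * (C + 1) / r"
  have m: "0 < m" "C / m < r / 2"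
    using r C0 by (auto simp: m_def field_simps)
  have "(\<lambda>n. expectation (\<lambda>\<omega>. min \<bar>Y n \<omega>\<bar> m)) \<longlonglongrightarrow> expectation (\<lambda>\<omega>. 0)"
  proof (rule integral_dominated_convergence)
    show "AE \<omega> in M. (\<lambda>n. min \<bar>Y n \<omega>\<bar> m) \<longlonglongrightarrow> 0"
      using lim
    proof eventually_elim
      case (elim \<omega>)
      have "(\<lambda>n. min \<bar>Y n \<omega>\<bar> m) \<longlonglongrightarrow> min \<bar>0\<bar> m"
        by (intro tendsto_intros elim)
      with m show ?case by simp
    qed
    show "AE \<omega> in M. norm (min \<bar>Y n \<omega>\<bar> m) \<le> m" for n
      using m by (auto simp: min_def)
  qed auto
  then have "eventually (\<lambda>n. expectation (\<lambda>\<omega>. min \<bar>Y n \<omega>\<bar> m) < r / 2) sequentially"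
    using r by (intro order_tendstoD(2)) auto
  then obtain N where N: "\<And>n. n \<ge> N \<Longrightarrow> expectation (\<lambda>\<omega>. min \<bar>Y n \<omega>\<bar> m) < r / 2"
    by (auto simp: eventually_sequentially)
  have "norm (expectation (Y n) - 0) < r" if "n \<ge> N" for n
  proof -
    have imin: "integrable M (\<lambda>\<omega>. min \<bar>Y n \<omega>\<bar> m)"
      using m by (intro integrable_const_bound[of _ m]) (auto simp: min_def)
    have iY: "integrable M (\<lambda>\<omega>. \<bar>Y n \<omega>\<bar>)"
      using square_integrable_imp_integrable[OF meas int] by simp
    have pt: "\<bar>y\<bar> \<le> min \<bar>y\<bar> m + y\<^sup>2 / m" for y :: real
    proof (cases "\<bar>y\<bar> \<le> m")
      case False
      with m have "m * \<bar>y\<bar> \<le> y\<^sup>2"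
        using mult_right_mono[of m "\<bar>y\<bar>" "\<bar>y\<bar>"] by (simp add: power2_eq_square)
      with m have "\<bar>y\<bar> \<le> y\<^sup>2 / m" by (simp add: field_simps)
      with m show ?thesis by (simp add: min_def)
    qed (use m in simp)
    have "\<bar>expectation (Y n)\<bar> \<le> expectation (\<lambda>\<omega>. \<bar>Y n \<omega>\<bar>)" by (rule integral_abs_bound)
    also have "\<dots> \<le> expectation (\<lambda>\<omega>. min \<bar>Y n \<omega>\<bar> m + (Y n \<omega>)\<^sup>2 / m)"
      using imin iY int pt by (intro integral_mono) auto
    also have "\<dots> = expectation (\<lambda>\<omega>. min \<bar>Y n \<omega>\<bar> m) + expectation (\<lambda>\<omega>. (Y n \<omega>)\<^sup>2) / m"
      using imin int by simp
    also have "\<dots> < r / 2 + r / 2"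
      using N[OF that] m divide_right_mono[OF bound[of n], of m] by linarith
    finally show ?thesis by simp
  qed
  then show "\<exists>N. \<forall>n\<ge>N. norm (expectation (Y n) - 0) < r" by blast
qed

lemma left_prod_cong:
  "(\<And>k. 1 \<le> k \<Longrightarrow> k \<le> n \<Longrightarrow> X k = Y k) \<Longrightarrow> left_prod X n = left_prod Y n"
  by (induction n) auto

lemma left_prod_nonzero_orthant:
  assumes "\<And>k. 1 \<le> k \<Longrightarrow> entries_comparable \<kappa> (X k)" "x \<in> nonzero_orthant"
  shows "left_prod X n *v x \<in> nonzero_orthant"
proof (induction n)
  case (Suc n)
  have "X (Suc n) *v (left_prod X n *v x) \<in> nonzero_orthant"
    by (rule nonzero_orthant_mv[OF assms(1) Suc]) simp
  then show ?case by (simp add: matrix_vector_mul_assoc)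
qed (use assms(2) in simp)

lemma left_prod_nonneg:
  assumes "\<And>k. 1 \<le> k \<Longrightarrow> X k \<in> nonneg_mats"
  shows "left_prod X n \<in> nonneg_mats"
proof (induction n)
  case (Suc n)
  then show ?case
    using assms[of "Suc n"] by (auto simp: nonneg_mats_def matrix_matrix_mult_def intro!: sum_nonneg)
qed (simp add: nonneg_mats_def mat_def)

lemma ln_left_prod_bound:
  assumes X: "\<And>k. 1 \<le> k \<Longrightarrow> entries_comparable \<kappa> (X k)" and x: "x \<in> nonzero_orthant"
  shows "\<bar>ln (norm1 (left_prod X n *v x)) - ln (norm1 x)\<bar> \<le> (\<Sum>k=1..n. ln (distortion (X k)))"
proof (induction n)
  case (Suc n)
  have g: "entries_comparable \<kappa> (X (Suc n))" by (rule X) simp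
  have "\<bar>ln (norm1 (X (Suc n) *v (left_prod X n *v x))) - ln (norm1 (left_prod X n *v x))\<bar>
      \<le> ln (distortion (X (Suc n)))"
    using left_prod_nonzero_orthant[OF X x, where n = n]
    by (intro ln_norm1_mv(2) comparable_nonneg[OF g] comparable_colsum_pos[OF g]) auto
  with Suc show ?case by (simp add: matrix_vector_mul_assoc)
qed simp

context comparable_matrix_law
begin

context
  fixes P :: "'w measure" and X :: "nat \<Rightarrow> 'w \<Rightarrow> real ^ 'n ^ 'n"
  assumes P: "prob_space P"
    and indep: "prob_space.indep_vars P (\<lambda>_. borel) X {1..}"
    and law: "\<And>k. 1 \<le> k \<Longrightarrow> distr P borel (X k) = \<mu>"
begin

interpretation P: prob_space P by (rule P)

lemma factor_measurable: "1 \<le> k \<Longrightarrow> X k \<in> borel_measurable P"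
  using indep unfolding P.indep_vars_def by auto

lemma left_prod_measurable: "(\<lambda>\<omega>. left_prod (\<lambda>k. X k \<omega>) n) \<in> borel_measurable P"
proof (induction n)
  case (Suc n)
  note [measurable] = this factor_measurable[of "Suc n", simplified]
  show ?case by simp
qed simp

lemma factors_comparable: "AE \<omega> in P. \<forall>k\<ge>1. entries_comparable \<kappa> (X k \<omega>)"
proof -
  have "AE \<omega> in P. 1 \<le> k \<longrightarrow> entries_comparable \<kappa> (X k \<omega>)" for k
  proof (cases "1 \<le> k")
    case True
    have "AE g in distr P borel (X k). entries_comparable \<kappa> g"
      using comparable by (simp only: law[OF True])
    from AE_distrD[OF factor_measurable[OF True] this] show ?thesis by simp
  qed simp
  then show ?thesis by (simp add: AE_all_countable)
qed

lemma ln_distortion_factor: "1 \<le> k \<Longrightarrow> integrable P (\<lambda>\<omega>. ln (distortion (X k \<omega>)))"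
proof -
  assume k: "1 \<le> k"
  have "integrable (distr P borel (X k)) (\<lambda>g. ln (distortion g))"
    using ln_distortion by (simp only: law[OF k])
  with factor_measurable[OF k] show ?thesis
    by (subst (asm) integrable_distr_eq) auto
qed

lemma left_prod_indep:
  "P.indep_var borel (\<lambda>\<omega>. left_prod (\<lambda>k. X k \<omega>) n) borel (X (Suc n))"
proof -
  have lp: "(\<lambda>f. left_prod f m) \<in> borel_measurable (PiM {1..n} (\<lambda>_. borel :: (real ^ 'n ^ 'n) measure))"
    if "m \<le> n" for m
    using that
  proof (induction m)
    case (Suc m)
    then have [measurable]:
      "(\<lambda>f. left_prod f m) \<in> borel_measurable (PiM {1..n} (\<lambda>_. borel :: (real ^ 'n ^ 'n) measure))"
      and "Suc m \<in> {1..n}" by auto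
    then have [measurable]:
      "(\<lambda>f. f (Suc m)) \<in> borel_measurable (PiM {1..n} (\<lambda>_. borel :: (real ^ 'n ^ 'n) measure))"
      by (intro measurable_component_singleton)
    show ?case unfolding left_prod.simps by measurable
  qed simp
  have c: "(\<lambda>f. f (Suc n)) \<in> borel_measurable (PiM {Suc n} (\<lambda>_. borel :: (real ^ 'n ^ 'n) measure))"
    by (rule measurable_component_singleton) simp
  have "P.indep_var borel ((\<lambda>f. left_prod f n) \<circ> (\<lambda>\<omega>. restrict (\<lambda>k. X k \<omega>) {1..n}))
      borel ((\<lambda>f. f (Suc n)) \<circ> (\<lambda>\<omega>. restrict (\<lambda>k. X k \<omega>) {Suc n}))"
    by (rule P.indep_var_compose[OF P.indep_var_restrict[OF indep] lp c]) auto
  also have "(\<lambda>f. left_prod f n) \<circ> (\<lambda>\<omega>. restrict (\<lambda>k. X k \<omega>) {1..n}) = (\<lambda>\<omega>. left_prod (\<lambda>k. X k \<omega>) n)"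
    by (auto simp: fun_eq_iff intro!: left_prod_cong)
  also have "(\<lambda>f. f (Suc n)) \<circ> (\<lambda>\<omega>. restrict (\<lambda>k. X k \<omega>) {Suc n}) = X (Suc n)"
    by (auto simp: fun_eq_iff)
  finally show ?thesis .
qed

text \<open>Peeling off the last factor, which is independent of the product of the others, turns it into one
application of the transfer operator. This is why the claim is generalised to \<open>log_growth m\<close> in
place of \<open>ln |.|\<close>.\<close>

lemma log_growth_left_prod:
  assumes x: "x \<in> nonzero_orthant"
  shows "integrable P (\<lambda>\<omega>. log_growth m (left_prod (\<lambda>k. X k \<omega>) n *v x))"
    and "P.expectation (\<lambda>\<omega>. log_growth m (left_prod (\<lambda>k. X k \<omega>) n *v x)) = log_growth (m + n) x"
proof -
  note [measurable] = left_prod_measurable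
  show int: "integrable P (\<lambda>\<omega>. log_growth m (left_prod (\<lambda>k. X k \<omega>) n *v x))" for m n
  proof (rule Bochner_Integration.integrable_bound)
    let ?d = "real m * expectation (\<lambda>g. ln (distortion g))"
    show "integrable P (\<lambda>\<omega>. \<bar>ln (norm1 x)\<bar> + ?d + (\<Sum>k=1..n. ln (distortion (X k \<omega>))))"
      by (intro Bochner_Integration.integrable_add P.integrable_const
          Bochner_Integration.integrable_sum ln_distortion_factor) auto
    show "AE \<omega> in P. norm (log_growth m (left_prod (\<lambda>k. X k \<omega>) n *v x))
        \<le> norm (\<bar>ln (norm1 x)\<bar> + ?d + (\<Sum>k=1..n. ln (distortion (X k \<omega>))))"
      using factors_comparable
    proof eventually_elim
      case (elim \<omega>)
      then have c: "\<And>k. 1 \<le> k \<Longrightarrow> entries_comparable \<kappa> (X k \<omega>)" by blast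
      show ?case
        using ln_left_prod_bound[of \<kappa> "\<lambda>k. X k \<omega>" x n, OF c x]
          log_growth_crude(1)[OF left_prod_nonzero_orthant[of \<kappa> "\<lambda>k. X k \<omega>" x n, OF c x], where n = m] by simp
    qed
  qed measurable
  show "P.expectation (\<lambda>\<omega>. log_growth m (left_prod (\<lambda>k. X k \<omega>) n *v x)) = log_growth (m + n) x"
  proof (induction n arbitrary: m)
    case 0
    show ?case by (simp add: P.prob_space)
  next
    case (Suc n)
    let ?L = "\<lambda>\<omega>. left_prod (\<lambda>k. X k \<omega>) n" and ?h = "\<lambda>(l, g). log_growth m (g *v (l *v x))"
    note [measurable] = factor_measurable[of "Suc n", simplified]
    have joint: "distr P borel ?L \<Otimes>\<^sub>M \<mu> = distr P (borel \<Otimes>\<^sub>M borel) (\<lambda>\<omega>. (?L \<omega>, X (Suc n) \<omega>))"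
      using left_prod_indep[of n] law[of "Suc n"] by (simp add: P.indep_var_distribution_eq)
    interpret L: prob_space "distr P borel ?L" by (rule P.prob_space_distr) measurable
    interpret pair_sigma_finite "distr P borel ?L" \<mu> ..
    have h [measurable]: "?h \<in> borel_measurable (borel \<Otimes>\<^sub>M borel)" by measurable
    have ih: "integrable (distr P borel ?L \<Otimes>\<^sub>M \<mu>) ?h"
      using int[of m "Suc n"] unfolding joint
      by (subst integrable_distr_eq) (auto simp: matrix_vector_mul_assoc)
    have "P.expectation (\<lambda>\<omega>. log_growth m (left_prod (\<lambda>k. X k \<omega>) (Suc n) *v x))
        = (\<integral>p. ?h p \<partial>(distr P borel ?L \<Otimes>\<^sub>M \<mu>))"
      unfolding joint by (subst integral_distr) (auto simp: matrix_vector_mul_assoc)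
    also have "\<dots> = (\<integral>l. (\<integral>g. log_growth m (g *v (l *v x)) \<partial>\<mu>) \<partial>distr P borel ?L)"
      using integral_fst'[OF ih] by simp
    also have "\<dots> = P.expectation (\<lambda>\<omega>. log_growth (Suc m) (?L \<omega> *v x))"
      unfolding log_growth_Suc[symmetric] by (subst integral_distr) auto
    also have "\<dots> = log_growth (Suc m + n) x" by (rule Suc.IH)
    finally show ?case by simp
  qed
qed

text \<open>The almost sure exponent is transported to expectations. The vector with all coordinates \<open>1\<close> is
convenient because the norm of its image is the sum of all entries, which agrees with \<open>mat_norm\<close> up
to a factor between \<open>1\<close> and \<open>CARD('n)\<close>. The second moments of the normalised logarithms are bounded by
convexity of the square.\<close>

lemma log_growth_sublinear:
  assumes square: "integrable \<mu> (\<lambda>g. (ln (distortion g))\<^sup>2)"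
    and lyapunov: "AE \<omega> in P. (\<lambda>n. ln (mat_norm (left_prod (\<lambda>k. X k \<omega>) n)) / real n) \<longlonglongrightarrow> 0"
  shows "(\<lambda>n. log_growth n (\<chi> i. 1) / real n) \<longlonglongrightarrow> 0"
proof -
  define u :: "real ^ 'n" where "u = (\<chi> i. 1)"
  let ?d = "real CARD('n)"
  have u: "u \<in> nonzero_orthant" "norm1 u = ?d"
    by (auto simp: u_def nonneg_orthant_def vec_eq_iff norm1_def)
  have d1: "1 \<le> ?d" by (simp add: Suc_le_eq)
  note [measurable] = left_prod_measurable
  define Y where "Y n \<omega> = ln (norm1 (left_prod (\<lambda>k. X k \<omega>) n *v u)) / real n" for n \<omega>
  have Y_meas [measurable]: "Y n \<in> borel_measurable P" for n
    unfolding Y_def[abs_def] by measurable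
  have lim: "AE \<omega> in P. (\<lambda>n. Y n \<omega>) \<longlonglongrightarrow> 0"
    using lyapunov factors_comparable
  proof eventually_elim
    case (elim \<omega>)
    let ?L = "left_prod (\<lambda>k. X k \<omega>)"
    let ?a = "\<lambda>n. ln (mat_norm (?L n)) / real n"
    have c: "\<And>k. 1 \<le> k \<Longrightarrow> entries_comparable \<kappa> (X k \<omega>)" using elim(2) by blast
    have Y_between: "?a n \<le> Y n \<omega> \<and> Y n \<omega> \<le> ?a n + ln ?d * inverse (real n)" for n
    proof -
      have L: "?L n \<in> nonneg_mats" by (rule left_prod_nonneg) (rule comparable_nonneg[OF c])
      have pos: "0 < norm1 (?L n *v u)" 
        using left_prod_nonzero_orthant[of \<kappa> "\<lambda>k. X k \<omega>" u n, OF c u(1)] by (simp add: norm1_pos)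
      have eq: "norm1 (?L n *v u) = (\<Sum>j\<in>UNIV. colsum (?L n) j)"
        using u by (subst norm1_mv[OF L]) (auto simp: u_def)
      have le: "mat_norm (?L n) \<le> norm1 (?L n *v u)"
        unfolding eq by (rule mat_norm_bounds(2)[OF L])
      have ge: "norm1 (?L n *v u) \<le> ?d * mat_norm (?L n)"
        unfolding eq by (rule sum_bounded_above[of UNIV, simplified]) (rule mat_norm_bounds(1)[OF L])
      with pos have mp: "0 < mat_norm (?L n)" using d1 by (smt (verit) zero_less_mult_iff)
      have "ln (norm1 (?L n *v u)) \<le> ln (?d * mat_norm (?L n))"
        using pos mp ge d1 by (subst ln_le_cancel_iff) auto
      also have "\<dots> = ln ?d + ln (mat_norm (?L n))" using mp by (simp add: ln_mult)
      finally have 1: "ln (norm1 (?L n *v u)) \<le> ln (mat_norm (?L n)) + ln ?d" by simp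
      have 2: "ln (mat_norm (?L n)) \<le> ln (norm1 (?L n *v u))"
        using pos mp le by (subst ln_le_cancel_iff) auto
      show ?thesis
        using divide_right_mono[OF 1, of "real n"] divide_right_mono[OF 2, of "real n"]
        by (simp add: Y_def divide_inverse distrib_right)
    qed
    have up: "(\<lambda>n. ?a n + ln ?d * inverse (real n)) \<longlonglongrightarrow> 0 + ln ?d * 0"
      by (intro tendsto_intros elim lim_inverse_n)
    have "eventually (\<lambda>n. ?a n \<le> Y n \<omega>) sequentially"
      "eventually (\<lambda>n. Y n \<omega> \<le> ?a n + ln ?d * inverse (real n)) sequentially"
      using Y_between by (simp_all only: eventually_True)
    from tendsto_sandwich[OF this elim(1)] up show ?case by simp
  qed
  let ?q = "\<lambda>g. (ln ?d + ln (distortion g))\<^sup>2"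
  have q: "integrable \<mu> ?q"
    using square ln_distortion by (auto simp: power2_sum)
  have q_factor: "integrable P (\<lambda>\<omega>. ?q (X k \<omega>))" "P.expectation (\<lambda>\<omega>. ?q (X k \<omega>)) = expectation ?q"
    if k: "1 \<le> k" for k
  proof -
    note [measurable] = factor_measurable[OF k]
    show "integrable P (\<lambda>\<omega>. ?q (X k \<omega>))"
      using q unfolding law[OF k, symmetric] by (subst (asm) integrable_distr_eq) auto
    show "P.expectation (\<lambda>\<omega>. ?q (X k \<omega>)) = expectation ?q"
      unfolding law[OF k, symmetric] by (subst integral_distr) auto
  qed
  have sq: "AE \<omega> in P. (Y n \<omega>)\<^sup>2 \<le> (\<Sum>k=1..n. ?q (X k \<omega>)) / real n" for n
    using factors_comparable
  proof eventually_elim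
    case (elim \<omega>)
    then have c: "\<And>k. 1 \<le> k \<Longrightarrow> entries_comparable \<kappa> (X k \<omega>)" by blast
    show ?case
    proof (cases "n = 0")
      case False
      let ?s = "\<Sum>k=1..n. ln ?d + ln (distortion (X k \<omega>))"
      have lb: "\<bar>ln (norm1 (left_prod (\<lambda>k. X k \<omega>) n *v u)) - ln (norm1 u)\<bar>
          \<le> (\<Sum>k=1..n. ln (distortion (X k \<omega>)))"
        by (rule ln_left_prod_bound[OF c u(1)])
      have "\<bar>ln (norm1 (left_prod (\<lambda>k. X k \<omega>) n *v u))\<bar> \<le> ln ?d + (\<Sum>k=1..n. ln (distortion (X k \<omega>)))"
        using lb ln_ge_zero[OF d1] unfolding u(2) by linarith
      also have "\<dots> \<le> real n * ln ?d + (\<Sum>k=1..n. ln (distortion (X k \<omega>)))"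
        using False d1 mult_right_mono[of 1 "real n" "ln ?d"] by simp
      also have "\<dots> = ?s" by (simp add: sum.distrib)
      finally have "\<bar>ln (norm1 (left_prod (\<lambda>k. X k \<omega>) n *v u))\<bar> \<le> \<bar>?s\<bar>" by linarith
      then have "(ln (norm1 (left_prod (\<lambda>k. X k \<omega>) n *v u)))\<^sup>2 \<le> ?s\<^sup>2"
        by (simp only: abs_le_square_iff)
      also have "\<dots> \<le> real n * (\<Sum>k=1..n. ?q (X k \<omega>))"
        using sum_squared_le_sum_of_squares[of "\<lambda>k. ln ?d + ln (distortion (X k \<omega>))" "{1..n}"]
        by (simp add: mult.commute)
      finally have "(ln (norm1 (left_prod (\<lambda>k. X k \<omega>) n *v u)))\<^sup>2 / (real n)\<^sup>2
          \<le> real n * (\<Sum>k=1..n. ?q (X k \<omega>)) / (real n)\<^sup>2"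
        by (rule divide_right_mono) simp
      then show ?thesis
        using False by (simp add: Y_def power_divide power2_eq_square)
    qed (simp add: Y_def)
  qed
  have int_sum: "integrable P (\<lambda>\<omega>. (\<Sum>k=1..n. ?q (X k \<omega>)) / real n)" for n
    by (intro Bochner_Integration.integrable_divide_zero Bochner_Integration.integrable_sum q_factor(1)) auto
  have Y_int: "integrable P (\<lambda>\<omega>. (Y n \<omega>)\<^sup>2)" for n
  proof (rule Bochner_Integration.integrable_bound[OF int_sum[of n]])
    show "AE \<omega> in P. norm ((Y n \<omega>)\<^sup>2) \<le> norm ((\<Sum>k=1..n. ?q (X k \<omega>)) / real n)"
      using sq[of n] by eventually_elim (simp add: abs_of_nonneg sum_nonneg)
  qed measurable
  have Y_bd: "P.expectation (\<lambda>\<omega>. (Y n \<omega>)\<^sup>2) \<le> expectation ?q" for n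
  proof -
    have "P.expectation (\<lambda>\<omega>. (Y n \<omega>)\<^sup>2) \<le> P.expectation (\<lambda>\<omega>. (\<Sum>k=1..n. ?q (X k \<omega>)) / real n)"
      by (rule integral_mono_AE[OF Y_int int_sum sq])
    also have "\<dots> = (\<Sum>k=1..n. P.expectation (\<lambda>\<omega>. ?q (X k \<omega>))) / real n"
      using q_factor(1) by (subst Bochner_Integration.integral_divide_zero, subst Bochner_Integration.integral_sum) auto
    also have "\<dots> = (\<Sum>k=1..n. expectation ?q) / real n"
      using q_factor(2) by simp
    also have "\<dots> \<le> expectation ?q"
      by (cases "n = 0") (auto intro!: integral_nonneg_AE)
    finally show ?thesis .
  qed
  have "(\<lambda>n. P.expectation (Y n)) \<longlonglongrightarrow> 0"
    by (rule P.expectation_tendsto_0_of_bounded_square[OF Y_meas lim Y_int Y_bd])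
  moreover have "P.expectation (Y n) = log_growth n u / real n" for n
    using log_growth_left_prod(2)[OF u(1), of 0 n] by (simp add: Y_def[abs_def])
  ultimately show ?thesis by (simp add: u_def)
qed

end

end

section \<open>A function with summable drift along the affine recursion\<close>

lemma ln_one_plus_le_powr:
  fixes y \<epsilon> :: real
  assumes y: "0 \<le> y" and \<epsilon>: "0 < \<epsilon>" "\<epsilon> \<le> 1"
  shows "ln (1 + y) \<le> 2 / \<epsilon> * y powr \<epsilon>"
proof (cases "y \<le> 1")
  case True
  have "ln (1 + y) \<le> y" using y by (rule ln_add_one_self_le_self)
  also have "y \<le> y powr \<epsilon>" using powr_mono'[of \<epsilon> 1 y] y True \<epsilon> by simp
  also have "\<dots> \<le> 2 / \<epsilon> * y powr \<epsilon>"
    using \<epsilon> mult_right_mono[of 1 "2 / \<epsilon>" "y powr \<epsilon>"] by simp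
  finally show ?thesis .
next
  case False
  have "ln (1 + y) \<le> ln (2 * y)" using False by simp
  also have "\<dots> = ln 2 + ln y" using False by (simp add: ln_mult)
  also have "\<dots> \<le> 1 + y powr \<epsilon> / \<epsilon>"
    using ln_powr_bound[of y \<epsilon>] ln_le_minus_one[of 2] False \<epsilon> by simp
  also have "1 \<le> y powr \<epsilon> / \<epsilon>"
    using False \<epsilon> ge_one_powr_ge_zero[of y \<epsilon>] by (simp add: le_divide_eq)
  finally show ?thesis by simp
qed

lemma inverse_le_divide:
  fixes a b d :: real
  assumes "0 < a" "0 < b" "b \<le> d * a"
  shows "inverse a \<le> d / b"
  using assms by (simp add: field_simps)

context comparable_matrix_law
begin

text \<open>\<open>w(x) = liminf\<^sub>n p\<^sub>n(x + e) + ln \<kappa>\<close> with a fixed vector \<open>e\<close> of norm \<open>1\<close>. The shift by \<open>e\<close> keeps the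
argument away from the singularity of the logarithm at \<open>0\<close>, so that \<open>w \<ge> 0\<close> and Fatou's lemma
applies. The drift inequality survives it: the shift is absorbed into \<open>B\<close>, since \<open>A x + B + e \<le> A (x + e) + (B + e)\<close>.\<close>

lemma lyapunov_function:
  fixes P :: "'w measure" and A :: "'w \<Rightarrow> real ^ 'n ^ 'n" and B :: "'w \<Rightarrow> real ^ 'n"
  assumes "prob_space P"
    and A [measurable]: "A \<in> borel_measurable P" and B [measurable]: "B \<in> borel_measurable P"
    and B_orthant: "\<And>\<omega>. \<omega> \<in> space P \<Longrightarrow> B \<omega> \<in> nonneg_orthant"
    and law: "distr P borel A = \<mu>"
    and bounded: "\<And>n x. x \<in> nonzero_orthant \<Longrightarrow> \<bar>log_growth n x - ln (norm1 x)\<bar> \<le> ln \<kappa>"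
    and \<epsilon>: "0 < \<epsilon>" "\<epsilon> \<le> 1"
    and moment: "integrable P (\<lambda>\<omega>. (distortion (A \<omega>) * (1 + norm1 (B \<omega>))) powr \<epsilon>)"
  obtains w D where "w \<in> borel_measurable borel" "0 \<le> D"
    "\<And>x. x \<in> nonneg_orthant \<Longrightarrow> ln (1 + norm1 x) \<le> w x"
    "\<And>x. x \<in> nonneg_orthant \<Longrightarrow> w x \<le> ln (1 + norm1 x) + 2 * ln \<kappa>"
    "\<And>x. x \<in> nonneg_orthant \<Longrightarrow> (\<integral>\<^sup>+\<omega>. ennreal (w (A \<omega> *v x + B \<omega>)) \<partial>P)
        \<le> ennreal (w x + D * (1 + norm1 x) powr (- \<epsilon>))"
proof -
  interpret P: prob_space P by fact
  obtain i0 :: 'n where True by blast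
  define e :: "real ^ 'n" where "e = axis i0 1"
  have e: "e \<in> nonneg_orthant" "norm1 e = 1"
    by (auto simp: e_def axis_orthant norm1_axis)
  have shift: "x + e \<in> nonzero_orthant" "norm1 (x + e) = 1 + norm1 x" if "x \<in> nonneg_orthant" for x
  proof -
    show n: "norm1 (x + e) = 1 + norm1 x"
      using that e by (simp add: norm1_add_orthant)
    then have "x + e \<noteq> 0" using norm1_nonneg[of x] by (metis add_nonneg_eq_0_iff norm1_zero zero_neq_one zero_le_one)
    with that e add_orthant show "x + e \<in> nonzero_orthant" by blast
  qed
  have k0: "0 \<le> ln \<kappa>" "0 < \<kappa>" using kappa_ge_1 by auto
  have AE_A: "AE \<omega> in P. entries_comparable \<kappa> (A \<omega>)"
    using comparable unfolding law[symmetric] by (rule AE_distrD[OF A])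
  define M where "M \<omega> = (distortion (A \<omega>) * (1 + norm1 (B \<omega>))) powr \<epsilon>" for \<omega>
  have M: "integrable P M" using moment by (simp add: M_def[abs_def])
  have M0: "0 \<le> M \<omega>" for \<omega> by (simp add: M_def)
  define C where "C = 2 / \<epsilon> * \<kappa> powr \<epsilon>"
  have C0: "0 \<le> C" using \<epsilon> by (simp add: C_def)
  define D where "D = C * P.expectation M"
  have D0: "0 \<le> D" using C0 M0 by (simp add: D_def)
  define v where "v n x = log_growth n (x + e) + ln \<kappa>" for n x
  have v_meas [measurable]: "v n \<in> borel_measurable borel" for n
    unfolding v_def[abs_def] by measurable
  have v_bounds: "ln (1 + norm1 x) \<le> v n x" "v n x \<le> ln (1 + norm1 x) + 2 * ln \<kappa>"
    if "x \<in> nonneg_orthant" for n x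
    using bounded[OF shift(1)[OF that], of n] shift(2)[OF that] unfolding v_def by auto
  have ln0: "0 \<le> ln (1 + norm1 (x :: real ^ 'n))" for x using norm1_nonneg[of x] by simp
  have v0: "0 \<le> v n x" if "x \<in> nonneg_orthant" for n x
    using v_bounds(1)[OF that, of n] ln0[of x] by linarith

  have step: "AE \<omega> in P. A \<omega> *v x + B \<omega> \<in> nonneg_orthant \<and>
      v n (A \<omega> *v x + B \<omega>) \<le> log_growth n (A \<omega> *v (x + e)) + ln \<kappa>
        + C * (1 + norm1 x) powr (- \<epsilon>) * M \<omega>"
    if x: "x \<in> nonneg_orthant" for n x
    using AE_A AE_space
  proof eventually_elim
    case (elim \<omega>)
    let ?g = "A \<omega>" and ?b = "B \<omega> + e" and ?y = "x + e"
    note g = comparable_nonneg[OF elim(1)] and pos = comparable_colsum_pos[OF elim(1)]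
    have Bo: "B \<omega> \<in> nonneg_orthant" by (rule B_orthant[OF elim(2)])
    have o: "?g *v x + B \<omega> \<in> nonneg_orthant" by (intro add_orthant mv_orthant g x Bo)
    have gy: "?g *v ?y \<in> nonzero_orthant" by (rule nonzero_orthant_mv[OF elim(1) shift(1)[OF x]])
    have b: "?b \<in> nonneg_orthant" "norm1 ?b = 1 + norm1 (B \<omega>)"
      using Bo e by (simp_all add: add_orthant norm1_add_orthant)
    \<comment> \<open>the shift \<open>e\<close> is absorbed into the translation: \<open>A x + B + e\<close> is dominated by \<open>A (x + e) + (B + e)\<close>\<close>
    have "0 \<le> ?g *v e"
      using mv_orthant[OF g e(1)] by (simp add: nonneg_orthant_def less_eq_vec_def)
    then have "?g *v x + B \<omega> + e \<le> ?g *v ?y + ?b"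
      by (simp add: matrix_vector_right_distrib add_ac less_eq_vec_def)
    then have "log_growth n (?g *v x + B \<omega> + e) \<le> log_growth n (?g *v ?y + ?b)"
      by (rule log_growth_mono[OF shift(1)[OF o]])
    also have "\<dots> \<le> ln (1 + \<kappa> * norm1 ?b / norm1 (?g *v ?y)) + log_growth n (?g *v ?y)"
      by (rule log_growth_perturb[OF gy b(1)])
    also have "ln (1 + \<kappa> * norm1 ?b / norm1 (?g *v ?y)) \<le> C * (1 + norm1 x) powr (- \<epsilon>) * M \<omega>"
    proof -
      have ny: "0 < norm1 (?g *v ?y)" "0 < norm1 ?y" using gy shift[OF x] norm1_pos by blast+
      have dist: "1 \<le> distortion ?g" by (rule distortion_terms(3)[OF pos])
      have q0: "0 \<le> \<kappa> * norm1 ?b" using k0 by simp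
      have "\<kappa> * norm1 ?b / norm1 (?g *v ?y) \<le> \<kappa> * norm1 ?b * (distortion ?g / norm1 ?y)"
      proof -
        have "norm1 ?y \<le> distortion ?g * norm1 (?g *v ?y)"
          using norm1_mv_distortion(2)[OF g pos, of ?y] shift(1)[OF x] by blast
        from ny this have "inverse (norm1 (?g *v ?y)) \<le> distortion ?g / norm1 ?y"
          by (rule inverse_le_divide)
        from mult_left_mono[OF this q0] show ?thesis by (simp only: divide_inverse)
      qed
      also have "\<dots> = \<kappa> * (distortion ?g * (1 + norm1 (B \<omega>))) * inverse (1 + norm1 x)"
        by (simp add: b shift[OF x] divide_inverse)
      finally have "ln (1 + \<kappa> * norm1 ?b / norm1 (?g *v ?y))
          \<le> ln (1 + \<kappa> * (distortion ?g * (1 + norm1 (B \<omega>))) * inverse (1 + norm1 x))"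
        using divide_nonneg_pos[OF q0 ny(1)] by (subst ln_le_cancel_iff) linarith+
      also have "\<dots> \<le> 2 / \<epsilon> * (\<kappa> * (distortion ?g * (1 + norm1 (B \<omega>))) * inverse (1 + norm1 x)) powr \<epsilon>"
        using k0 dist \<epsilon> by (intro ln_one_plus_le_powr) auto
      also have "\<dots> = C * (1 + norm1 x) powr (- \<epsilon>) * M \<omega>"
        using k0 dist
        by (simp add: C_def M_def powr_mult powr_minus inverse_powr)
      finally show ?thesis .
    qed
    finally show ?case using o by (simp add: v_def)
  qed

  \<comment> \<open>the drift inequality holds for every finite \<open>n\<close>, with \<open>n + 1\<close> on the right; Fatou's lemma makes the two sides agree in the limit\<close>
  have v_step: "(\<integral>\<^sup>+\<omega>. ennreal (v n (A \<omega> *v x + B \<omega>)) \<partial>P)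
      \<le> ennreal (D * (1 + norm1 x) powr (- \<epsilon>)) + ennreal (v (Suc n) x)"
    if x: "x \<in> nonneg_orthant" for n x
  proof -
    let ?R = "\<lambda>\<omega>. log_growth n (A \<omega> *v (x + e)) + ln \<kappa> + C * (1 + norm1 x) powr (- \<epsilon>) * M \<omega>"
    have lg: "integrable P (\<lambda>\<omega>. log_growth n (A \<omega> *v (x + e)))"
      "P.expectation (\<lambda>\<omega>. log_growth n (A \<omega> *v (x + e))) = log_growth (Suc n) (x + e)"
    proof -
      have "integrable (distr P borel A) (\<lambda>g. log_growth n (g *v (x + e)))"
        using log_growth_crude(2)[OF shift(1)[OF x], of n] by (simp add: law)
      then show "integrable P (\<lambda>\<omega>. log_growth n (A \<omega> *v (x + e)))"
        by (subst (asm) integrable_distr_eq) measurable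
      show "P.expectation (\<lambda>\<omega>. log_growth n (A \<omega> *v (x + e))) = log_growth (Suc n) (x + e)"
        using integral_distr[of A P borel "\<lambda>g. log_growth n (g *v (x + e))"]
        by (simp add: log_growth_Suc law)
    qed
    have R: "integrable P ?R" using lg M by simp
    have R0: "AE \<omega> in P. 0 \<le> ?R \<omega>"
      using step[OF x, of n]
    proof eventually_elim
      case (elim \<omega>)
      with v0[of "A \<omega> *v x + B \<omega>" n] show ?case by linarith
    qed
    have "(\<integral>\<^sup>+\<omega>. ennreal (v n (A \<omega> *v x + B \<omega>)) \<partial>P) \<le> (\<integral>\<^sup>+\<omega>. ennreal (?R \<omega>) \<partial>P)"
      by (intro nn_integral_mono_AE eventually_mono[OF step[OF x, of n]]) (simp add: ennreal_leI)
    also have "\<dots> = ennreal (P.expectation ?R)"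
      by (rule nn_integral_eq_integral[OF R R0])
    also have "P.expectation ?R = D * (1 + norm1 x) powr (- \<epsilon>) + v (Suc n) x"
      using lg M by (simp add: P.prob_space v_def D_def mult_ac)
    also have "ennreal \<dots> = ennreal (D * (1 + norm1 x) powr (- \<epsilon>)) + ennreal (v (Suc n) x)"
      using D0 v0[OF x] by (intro ennreal_plus) auto
    finally show ?thesis .
  qed

  define W where "W x = liminf (\<lambda>n. ennreal (v n x))" for x
  define w where "w x = enn2real (W x)" for x
  have w_meas: "w \<in> borel_measurable borel"
    unfolding w_def[abs_def] W_def by measurable
  have W_lo: "ennreal (ln (1 + norm1 x)) \<le> W x"
      and W_up: "W x \<le> ennreal (ln (1 + norm1 x) + 2 * ln \<kappa>)" if x: "x \<in> nonneg_orthant" for x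
    unfolding W_def using v_bounds[OF x]
    by (auto intro!: Liminf_bounded Liminf_le always_eventually ennreal_leI)
  have W_w: "W x = ennreal (w x)" if x: "x \<in> nonneg_orthant" for x
    unfolding w_def using W_up[OF x] by (simp add: le_less_trans[OF _ ennreal_less_top])
  have w0: "0 \<le> w x" for x by (simp add: w_def)
  have w_bounds: "ln (1 + norm1 x) \<le> w x \<and> w x \<le> ln (1 + norm1 x) + 2 * ln \<kappa>"
    if x: "x \<in> nonneg_orthant" for x
  proof -
    have "0 \<le> ln (1 + norm1 x) + 2 * ln \<kappa>" using ln0[of x] k0 by linarith
    then show ?thesis
      using W_lo[OF x] W_up[OF x] unfolding W_w[OF x] ennreal_le_iff[OF w0]
      by (simp only: ennreal_le_iff)
  qed
  have drift: "(\<integral>\<^sup>+\<omega>. ennreal (w (A \<omega> *v x + B \<omega>)) \<partial>P) \<le> ennreal (w x + D * (1 + norm1 x) powr (- \<epsilon>))"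
    if x: "x \<in> nonneg_orthant" for x
  proof -
    let ?c = "ennreal (D * (1 + norm1 x) powr (- \<epsilon>))"
    have "(\<integral>\<^sup>+\<omega>. ennreal (w (A \<omega> *v x + B \<omega>)) \<partial>P) = (\<integral>\<^sup>+\<omega>. W (A \<omega> *v x + B \<omega>) \<partial>P)"
      by (intro nn_integral_cong_AE eventually_mono[OF step[OF x, of 0]]) (simp add: W_w)
    also have "\<dots> \<le> liminf (\<lambda>n. \<integral>\<^sup>+\<omega>. ennreal (v n (A \<omega> *v x + B \<omega>)) \<partial>P)"
      unfolding W_def by (intro nn_integral_liminf) measurable
    also have "\<dots> \<le> liminf (\<lambda>n. ?c + ennreal (v (Suc n) x))"
      by (intro Liminf_mono always_eventually allI v_step x)
    also have "\<dots> = ?c + W x"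
      unfolding W_def
      using liminf_shift[of "\<lambda>n. ennreal (v n x)"] by (subst Liminf_const_add) auto
    also have "\<dots> = ennreal (w x + D * (1 + norm1 x) powr (- \<epsilon>))"
      unfolding W_w[OF x] using D0 w0[of x] by (subst add.commute, subst ennreal_plus) auto
    finally show ?thesis .
  qed
  show thesis
    by (rule that[OF w_meas D0 conjunct1[OF w_bounds] conjunct2[OF w_bounds] drift])
qed

end

section \<open>Flux through level sets and the invariant measure\<close>

locale affine_recursion = prob_space P for P :: "'w measure" +
  fixes A :: "'w \<Rightarrow> real ^ 'n ^ 'n" and B :: "'w \<Rightarrow> real ^ 'n" and \<nu> :: "(real ^ 'n) measure"
  assumes A_measurable [measurable]: "A \<in> borel_measurable P"
    and B_measurable [measurable]: "B \<in> borel_measurable P"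
    and A_allowable: "\<And>\<omega>. \<omega> \<in> space P \<Longrightarrow> allowable (A \<omega>)"
    and B_orthant: "\<And>\<omega>. \<omega> \<in> space P \<Longrightarrow> B \<omega> \<in> nonneg_orthant"
    and radon: "radon_measure_on nonneg_orthant \<nu>"
    and invariant: "invariant_measure P A B \<nu>"
begin

lemma sets_nu: "sets \<nu> = sets (restrict_space borel nonneg_orthant)"
  using radon by (simp add: radon_measure_on_def)

lemma space_nu [simp]: "space \<nu> = nonneg_orthant"
  using sets_eq_imp_space_eq[OF sets_nu] by (simp add: space_restrict_space)

lemma measurable_nu [measurable (raw)]:
  "f \<in> measurable borel N \<Longrightarrow> f \<in> measurable \<nu> N"
  unfolding measurable_cong_sets[OF sets_nu refl] by (rule measurable_restrict_space1)

lemma sets_nu_Collect: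
  assumes "Measurable.pred borel Q" shows "{x \<in> nonneg_orthant. Q x} \<in> sets \<nu>"
  using measurable_sets[OF measurable_nu[OF assms], of "{True}"]
  by (simp add: vimage_def Int_def conj_commute)

lemma nu_ball_finite: "emeasure \<nu> {x \<in> nonneg_orthant. norm1 x \<le> r} < \<infinity>"
  using radon compact_norm1_ball[of r] unfolding radon_measure_on_def by blast

lemma sigma_finite_nu: "sigma_finite_measure \<nu>"
proof (rule sigma_finite_measure.intro, intro exI conjI)
  let ?F = "range (\<lambda>n. {x \<in> nonneg_orthant. norm1 (x :: real ^ 'n) \<le> real n})"
  show "countable ?F" by simp
  show "?F \<subseteq> sets \<nu>" by (auto intro!: sets_nu_Collect)
  show "\<Union>?F = space \<nu>" using real_arch_simple by auto
  show "\<forall>a\<in>?F. emeasure \<nu> a \<noteq> \<infinity>" using nu_ball_finite by (auto simp: less_top[symmetric])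
qed

interpretation nu: sigma_finite_measure \<nu> by (rule sigma_finite_nu)

interpretation pair_sigma_finite \<nu> P ..

lemma step_orthant:
  assumes "x \<in> nonneg_orthant" "\<omega> \<in> space P"
  shows "A \<omega> *v x + B \<omega> \<in> nonneg_orthant"
  using assms by (intro add_orthant mv_orthant allowable_nonneg A_allowable B_orthant)

lemma norm1_step_ge:
  assumes "x \<in> nonneg_orthant" "\<omega> \<in> space P"
  shows "norm1 (A \<omega> *v x) \<le> norm1 (A \<omega> *v x + B \<omega>)"
  using assms by (subst norm1_add_orthant) (auto intro: mv_orthant allowable_nonneg A_allowable B_orthant)

lemma integrable_nu:
  fixes h :: "real ^ 'n \<Rightarrow> real"
  assumes h [measurable]: "h \<in> borel_measurable borel"
    and bound: "\<And>x. x \<in> nonneg_orthant \<Longrightarrow> \<bar>h x\<bar> \<le> c"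
    and supp: "\<And>x. x \<in> nonneg_orthant \<Longrightarrow> r < norm1 x \<Longrightarrow> h x = 0"
  shows "integrable \<nu> h"
proof (rule Bochner_Integration.integrable_bound)
  let ?K = "{x \<in> nonneg_orthant. norm1 (x :: real ^ 'n) \<le> r}"
  have "?K \<in> sets \<nu>" by (rule sets_nu_Collect) measurable
  then show "integrable \<nu> (\<lambda>x. c * indicator ?K x :: real)"
    using nu_ball_finite[of r] by simp
  show "AE x in \<nu>. norm (h x) \<le> norm (c * indicator ?K x :: real)"
  proof (rule AE_I2)
    fix x assume x: "x \<in> space \<nu>"
    show "norm (h x) \<le> norm (c * indicator ?K x :: real)"
      using bound[of x] supp[of x] x by (cases "norm1 x \<le> r") auto
  qed
qed measurable

text \<open>The Bochner form of invariance, rewritten with nonnegative integrals so that Tonelli's theorem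
applies. The inner integrals are finite since \<open>A x + B\<close> in a compact set confines \<open>x\<close> to one.\<close>

lemma invariance:
  fixes f :: "real ^ 'n \<Rightarrow> real"
  assumes f [measurable]: "f \<in> borel_measurable borel"
    and bound: "\<And>x. x \<in> nonneg_orthant \<Longrightarrow> 0 \<le> f x \<and> f x \<le> c"
    and supp: "\<And>x. x \<in> nonneg_orthant \<Longrightarrow> r < norm1 x \<Longrightarrow> f x = 0"
  shows "(\<integral>\<^sup>+x. \<integral>\<^sup>+\<omega>. ennreal (f (A \<omega> *v x + B \<omega>)) \<partial>P \<partial>\<nu>) = (\<integral>\<^sup>+x. ennreal (f x) \<partial>\<nu>)"
    and "(\<integral>\<^sup>+x. ennreal (f x) \<partial>\<nu>) < \<infinity>"
proof -
  have "bounded_compact_test f"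
    unfolding bounded_compact_test_def
  proof (intro conjI exI[of _ "{x \<in> nonneg_orthant. norm1 x \<le> r}"] compact_norm1_ball)
    show "f \<in> borel_measurable (restrict_space borel nonneg_orthant)"
      by (rule measurable_restrict_space1) measurable
    show "bounded (f ` nonneg_orthant)"
      using bound by (intro boundedI[of _ c]) auto
  qed (use supp in \<open>auto simp: not_le\<close>)
  with invariant have inv: "integrable P (\<lambda>\<omega>. \<integral>x. f (A \<omega> *v x + B \<omega>) \<partial>\<nu>)"
    "(\<integral>x. f x \<partial>\<nu>) = (\<integral>\<omega>. (\<integral>x. f (A \<omega> *v x + B \<omega>) \<partial>\<nu>) \<partial>P)"
    unfolding invariant_measure_def by blast+
  have if': "integrable \<nu> f"
    by (rule integrable_nu[of f c r]) (use bound supp in auto)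
  have f_eq: "(\<integral>\<^sup>+x. ennreal (f x) \<partial>\<nu>) = ennreal (\<integral>x. f x \<partial>\<nu>)"
    using bound by (intro nn_integral_eq_integral if' AE_I2) simp
  then show "(\<integral>\<^sup>+x. ennreal (f x) \<partial>\<nu>) < \<infinity>" by simp
  have inner: "(\<integral>\<^sup>+x. ennreal (f (A \<omega> *v x + B \<omega>)) \<partial>\<nu>) = ennreal (\<integral>x. f (A \<omega> *v x + B \<omega>) \<partial>\<nu>)"
    if \<omega>: "\<omega> \<in> space P" for \<omega>
  proof (rule nn_integral_eq_integral)
    show "AE x in \<nu>. 0 \<le> f (A \<omega> *v x + B \<omega>)"
      using bound step_orthant[OF _ \<omega>] by (intro AE_I2) simp
    have pos: "\<And>j. 0 < colsum (A \<omega>) j"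
      by (rule colsum_pos_allowable[OF A_allowable[OF \<omega>]])
    have D: "1 \<le> distortion (A \<omega>)" by (rule distortion_terms(3)[OF pos])
    show "integrable \<nu> (\<lambda>x. f (A \<omega> *v x + B \<omega>))"
    proof (rule integrable_nu[where c = c and r = "distortion (A \<omega>) * r"])
      fix x :: "real ^ 'n" assume x: "x \<in> nonneg_orthant"
      show "\<bar>f (A \<omega> *v x + B \<omega>)\<bar> \<le> c" using bound[OF step_orthant[OF x \<omega>]] by simp
      assume "distortion (A \<omega>) * r < norm1 x"
      also have "norm1 x \<le> distortion (A \<omega>) * norm1 (A \<omega> *v x)"
        by (rule norm1_mv_distortion(2)[OF allowable_nonneg[OF A_allowable[OF \<omega>]] pos x])
      finally have "r < norm1 (A \<omega> *v x)" using D by simp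
      with norm1_step_ge[OF x \<omega>] supp[OF step_orthant[OF x \<omega>]]
      show "f (A \<omega> *v x + B \<omega>) = 0" by linarith
    qed measurable
  qed
  have "(\<integral>\<^sup>+x. \<integral>\<^sup>+\<omega>. ennreal (f (A \<omega> *v x + B \<omega>)) \<partial>P \<partial>\<nu>)
      = (\<integral>\<^sup>+\<omega>. \<integral>\<^sup>+x. ennreal (f (A \<omega> *v x + B \<omega>)) \<partial>\<nu> \<partial>P)"
  proof (rule Fubini'[symmetric])
    have "fst \<in> borel_measurable (\<nu> \<Otimes>\<^sub>M P)"
      by (rule measurable_compose[OF measurable_fst measurable_nu[OF measurable_ident_sets[OF refl]]])
    moreover have "(\<lambda>p. A (snd p)) \<in> borel_measurable (\<nu> \<Otimes>\<^sub>M P)"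
      "(\<lambda>p. B (snd p)) \<in> borel_measurable (\<nu> \<Otimes>\<^sub>M P)"
      by (rule measurable_compose[OF measurable_snd], measurable)+
    ultimately have "(\<lambda>p. f (A (snd p) *v fst p + B (snd p))) \<in> borel_measurable (\<nu> \<Otimes>\<^sub>M P)"
      by (intro measurable_compose[OF _ f] borel_measurable_add measurable_matrix_vector_mult)
    then show "(\<lambda>(x, \<omega>). ennreal (f (A \<omega> *v x + B \<omega>))) \<in> borel_measurable (\<nu> \<Otimes>\<^sub>M P)"
      unfolding case_prod_beta by (rule measurable_compose[OF _ measurable_ennreal])
  qed
  also have "\<dots> = (\<integral>\<^sup>+\<omega>. ennreal (\<integral>x. f (A \<omega> *v x + B \<omega>) \<partial>\<nu>) \<partial>P)"
    by (intro nn_integral_cong inner)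
  also have "\<dots> = ennreal (\<integral>\<omega>. (\<integral>x. f (A \<omega> *v x + B \<omega>) \<partial>\<nu>) \<partial>P)"
    using bound step_orthant
    by (intro nn_integral_eq_integral inv AE_I2 Bochner_Integration.integral_nonneg) simp
  also have "\<dots> = (\<integral>\<^sup>+x. ennreal (f x) \<partial>\<nu>)"
    by (simp add: f_eq inv(2))
  finally show "(\<integral>\<^sup>+x. \<integral>\<^sup>+\<omega>. ennreal (f (A \<omega> *v x + B \<omega>)) \<partial>P \<partial>\<nu>) = (\<integral>\<^sup>+x. ennreal (f x) \<partial>\<nu>)" .
qed

context
  fixes w h :: "real ^ 'n \<Rightarrow> real"
  assumes w [measurable]: "w \<in> borel_measurable borel"
    and h [measurable]: "h \<in> borel_measurable borel"
    and h_nonneg: "\<And>x. 0 \<le> h x"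
    and w_ge: "\<And>x. x \<in> nonneg_orthant \<Longrightarrow> ln (1 + norm1 x) \<le> w x"
    and drift: "\<And>x. x \<in> nonneg_orthant \<Longrightarrow>
      (\<integral>\<^sup>+\<omega>. ennreal (w (A \<omega> *v x + B \<omega>)) \<partial>P) \<le> ennreal (w x + h x)"
begin

lemma w_nonneg: "x \<in> nonneg_orthant \<Longrightarrow> 0 \<le> w x"
  using w_ge[of x] ln_ge_zero[of "1 + norm1 x"] norm1_nonneg[of x] by linarith

lemma w_le_imp_norm1_le: "x \<in> nonneg_orthant \<Longrightarrow> w x \<le> T \<Longrightarrow> norm1 x \<le> exp T"
proof -
  assume x: "x \<in> nonneg_orthant" and "w x \<le> T"
  with w_ge[OF x] have "ln (1 + norm1 x) \<le> T" by linarith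
  then have "exp (ln (1 + norm1 x)) \<le> exp T" by simp
  then have "1 + norm1 x \<le> exp T"
    using norm1_nonneg[of x] by simp
  then show ?thesis by simp
qed

text \<open>The tent function \<open>(T - w)\<^sup>+\<close> exceeds \<open>T - w\<close> exactly by the overshoot of \<open>w\<close> above \<open>T\<close>. Its integral
is preserved by the recursion, so the expected overshoot must be paid for by the drift. Values of
\<open>w(Ax + B)\<close> below \<open>T\<close> do not contribute on the left because \<open>ennreal\<close> truncates negative numbers
to \<open>0\<close>.\<close>

lemma upward_flux_bound:
  assumes T: "0 \<le> T"
  shows "(\<integral>\<^sup>+x. (\<integral>\<^sup>+\<omega>. ennreal (w (A \<omega> *v x + B \<omega>) - T) \<partial>P) * indicator {x. w x \<le> T} x \<partial>\<nu>)
    \<le> (\<integral>\<^sup>+x. ennreal (h x) \<partial>\<nu>)"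
proof -
  let ?f = "\<lambda>x. max 0 (T - w x)"
  let ?F = "\<lambda>x. \<integral>\<^sup>+\<omega>. ennreal (?f (A \<omega> *v x + B \<omega>)) \<partial>P"
  let ?X = "\<lambda>x. \<integral>\<^sup>+\<omega>. ennreal (w (A \<omega> *v x + B \<omega>) - T) \<partial>P"
  let ?I = "\<lambda>x. \<integral>\<^sup>+\<omega>. ennreal (w (A \<omega> *v x + B \<omega>)) \<partial>P"
  have f [measurable]: "?f \<in> borel_measurable borel" by measurable
  have inv: "(\<integral>\<^sup>+x. ?F x \<partial>\<nu>) = (\<integral>\<^sup>+x. ennreal (?f x) \<partial>\<nu>)" "(\<integral>\<^sup>+x. ennreal (?f x) \<partial>\<nu>) < \<infinity>"
  proof -
    have b: "0 \<le> ?f x \<and> ?f x \<le> T" if "x \<in> nonneg_orthant" for x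
      using w_nonneg[OF that] T by simp
    have s: "?f x = 0" if "x \<in> nonneg_orthant" "exp T < norm1 x" for x
      using w_le_imp_norm1_le[OF that(1), of T] that(2) by (cases "w x \<le> T") auto
    show "(\<integral>\<^sup>+x. ?F x \<partial>\<nu>) = (\<integral>\<^sup>+x. ennreal (?f x) \<partial>\<nu>)" "(\<integral>\<^sup>+x. ennreal (?f x) \<partial>\<nu>) < \<infinity>"
      by (rule invariance[OF f b s]; assumption)+
  qed
  have pt: "ennreal (?f x) + ?X x * indicator {x. w x \<le> T} x \<le> ?F x + ennreal (h x)"
    if x: "x \<in> nonneg_orthant" for x
  proof (cases "w x \<le> T")
    case True
    have "?F x + ?I x = (\<integral>\<^sup>+\<omega>. ennreal (?f (A \<omega> *v x + B \<omega>)) + ennreal (w (A \<omega> *v x + B \<omega>)) \<partial>P)"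
      by (rule nn_integral_add[symmetric]) measurable
    also have "\<dots> = (\<integral>\<^sup>+\<omega>. ennreal T + ennreal (w (A \<omega> *v x + B \<omega>) - T) \<partial>P)"
    proof (rule nn_integral_cong)
      fix \<omega> assume "\<omega> \<in> space P"
      then have "0 \<le> w (A \<omega> *v x + B \<omega>)" by (intro w_nonneg step_orthant x)
      then show "ennreal (?f (A \<omega> *v x + B \<omega>)) + ennreal (w (A \<omega> *v x + B \<omega>))
          = ennreal T + ennreal (w (A \<omega> *v x + B \<omega>) - T)"
        using T by (cases "w (A \<omega> *v x + B \<omega>) \<le> T")
          (auto simp: max_def ennreal_neg ennreal_plus[symmetric] simp del: ennreal_plus)
    qed
    also have "\<dots> = ennreal T + ?X x"
      by (subst nn_integral_add) (auto simp: emeasure_space_1)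
    finally have eq: "?F x + ?I x = ennreal T + ?X x" .
    have "ennreal (w x) + (ennreal (?f x) + ?X x) = ennreal T + ?X x"
      using True w_nonneg[OF x] by (simp add: add.assoc[symmetric] ennreal_plus[symmetric] del: ennreal_plus)
    also have "\<dots> \<le> ?F x + ennreal (w x + h x)"
      unfolding eq[symmetric] by (intro add_left_mono drift x)
    also have "\<dots> = ennreal (w x) + (?F x + ennreal (h x))"
      using w_nonneg[OF x] h_nonneg[of x] by (simp add: add_ac)
    finally have "ennreal (?f x) + ?X x \<le> ?F x + ennreal (h x)"
      by (simp add: ennreal_add_left_cancel_le)
    with True show ?thesis by simp
  qed simp
  have "(\<integral>\<^sup>+x. ennreal (?f x) \<partial>\<nu>) + (\<integral>\<^sup>+x. ?X x * indicator {x. w x \<le> T} x \<partial>\<nu>)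
      = (\<integral>\<^sup>+x. ennreal (?f x) + ?X x * indicator {x. w x \<le> T} x \<partial>\<nu>)"
    by (rule nn_integral_add[symmetric]) measurable
  also have "\<dots> \<le> (\<integral>\<^sup>+x. ?F x + ennreal (h x) \<partial>\<nu>)"
    by (intro nn_integral_mono pt) simp
  also have "\<dots> = (\<integral>\<^sup>+x. ?F x \<partial>\<nu>) + (\<integral>\<^sup>+x. ennreal (h x) \<partial>\<nu>)"
    by (rule nn_integral_add) measurable
  finally show ?thesis
    using inv(2) unfolding inv(1) ennreal_add_left_cancel_le by auto
qed

text \<open>Follow the sets \<open>E j\<close>: their lower edge moves outwards by the factor \<open>\<rho>\<close> at each step, but their upper
level \<open>T + j \<theta>\<close> only by \<open>\<theta> = ln \<rho> / 2\<close> on the logarithmic scale, so that \<open>E J\<close> is empty for some \<open>J\<close>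
that depends only on \<open>R\<close>. From \<open>E j\<close>, with probability at least \<open>q\<close>, the recursion either enters
\<open>E (j + 1)\<close> or overshoots the level \<open>T + j \<theta>\<close> by at least \<open>\<theta>\<close>, and the flux bound controls the latter
uniformly. Going back from \<open>E J\<close> to \<open>E 0\<close> bounds the measure of \<open>E 0\<close>.\<close>

lemma band_measure_bounded:
  assumes \<rho>: "1 < \<rho>" and S [measurable]: "S \<in> events" and S_pos: "0 < prob S"
    and expand: "\<And>\<omega> x. \<omega> \<in> S \<Longrightarrow> x \<in> nonneg_orthant \<Longrightarrow> \<rho> * norm1 x \<le> norm1 (A \<omega> *v x)"
    and finite: "(\<integral>\<^sup>+x. ennreal (h x) \<partial>\<nu>) < \<infinity>"
  shows "\<exists>K\<ge>0. \<forall>T s. 0 \<le> T \<longrightarrow> 0 < s \<longrightarrow> exp T \<le> R * s \<longrightarrow>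
    emeasure \<nu> {x \<in> nonneg_orthant. w x \<le> T \<and> s \<le> norm1 x} \<le> ennreal K"
proof -
  define G where "G = enn2real (\<integral>\<^sup>+x. ennreal (h x) \<partial>\<nu>)"
  have G: "(\<integral>\<^sup>+x. ennreal (h x) \<partial>\<nu>) = ennreal G" "0 \<le> G"
    using finite by (auto simp: G_def)
  define \<theta> where "\<theta> = ln \<rho> / 2"
  have \<theta>: "0 < \<theta>" "\<rho> = exp \<theta> * exp \<theta>"
    using \<rho> by (auto simp: \<theta>_def exp_add[symmetric])
  define q where "q = prob S"
  have q: "0 < q" using S_pos by (simp add: q_def)
  obtain J where J: "R < exp \<theta> ^ J"
    using real_arch_pow[of "exp \<theta>" R] \<theta>(1) by auto
  \<comment> \<open>the bound for \<open>E (J - i)\<close>, obtained by solving \<open>q * \<nu>(E j) \<le> \<nu>(E (j + 1)) + G / \<theta>\<close> backwards from \<open>\<nu>(E J) = 0\<close>\<close>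
  define k where "k i = ((\<lambda>c. (c + G / \<theta>) / q) ^^ i) 0" for i
  have k_Suc: "k (Suc i) = (k i + G / \<theta>) / q" for i by (simp add: k_def)
  have k0: "0 \<le> k i" for i
    by (induction i) (use G \<theta> q in \<open>auto simp: k_Suc, simp add: k_def\<close>)
  have "emeasure \<nu> {x \<in> nonneg_orthant. w x \<le> T \<and> s \<le> norm1 x} \<le> ennreal (k J)"
    if T: "0 \<le> T" and s: "0 < s" and R: "exp T \<le> R * s" for T s
  proof -
    define T' where "T' j = T + real j * \<theta>" for j
    have T'0: "0 \<le> T' j" for j using T \<theta> by (simp add: T'_def)
    define E where "E j = {x \<in> nonneg_orthant. w x \<le> T' j \<and> s * \<rho> ^ j \<le> norm1 x}" for j
    have E_borel [measurable]: "E j \<in> sets borel" for j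
      unfolding E_def by measurable
    have E_nu: "E j \<in> sets \<nu>" for j
      unfolding E_def by (rule sets_nu_Collect) measurable
    have E_empty: "E J = {}"
    proof (rule ccontr)
      assume "E J \<noteq> {}"
      then obtain x where x: "x \<in> nonneg_orthant" "w x \<le> T' J" "s * \<rho> ^ J \<le> norm1 x"
        by (auto simp: E_def)
      have "s * (exp \<theta> ^ J * exp \<theta> ^ J) = s * \<rho> ^ J" by (simp add: \<theta>(2) power_mult_distrib)
      also have "\<dots> \<le> exp (T' J)" using w_le_imp_norm1_le[OF x(1,2)] x(3) by linarith
      also have "\<dots> = exp T * exp \<theta> ^ J" by (simp add: T'_def exp_add exp_of_nat_mult)
      also have "\<dots> \<le> (R * s) * exp \<theta> ^ J" using R by (intro mult_right_mono) auto
      finally have "(s * exp \<theta> ^ J) * exp \<theta> ^ J \<le> (s * R) * exp \<theta> ^ J"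
        by (simp only: mult_ac)
      then have "s * exp \<theta> ^ J \<le> s * R"
        by (rule mult_right_le_imp_le) simp
      with s J show False by simp
    qed
    have step: "ennreal q * emeasure \<nu> (E j) \<le> emeasure \<nu> (E (Suc j)) + ennreal (G / \<theta>)" for j
    proof -
      let ?F = "\<lambda>x. \<integral>\<^sup>+\<omega>. ennreal (indicator (E (Suc j)) (A \<omega> *v x + B \<omega>)) \<partial>P"
      let ?X = "\<lambda>x. (\<integral>\<^sup>+\<omega>. ennreal (w (A \<omega> *v x + B \<omega>) - T' j) \<partial>P) * indicator {x. w x \<le> T' j} x"
      have pt: "ennreal q * indicator (E j) x \<le> ?F x + ennreal (1 / \<theta>) * ?X x"
        if x: "x \<in> nonneg_orthant" for x
      proof (cases "x \<in> E j")
        case True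
        have "ennreal q = (\<integral>\<^sup>+\<omega>. indicator S \<omega> \<partial>P)"
          by (simp add: q_def emeasure_eq_measure)
        also have "\<dots> \<le> (\<integral>\<^sup>+\<omega>. ennreal (indicator (E (Suc j)) (A \<omega> *v x + B \<omega>))
            + ennreal (1 / \<theta>) * ennreal (w (A \<omega> *v x + B \<omega>) - T' j) \<partial>P)"
        proof (rule nn_integral_mono)
          fix \<omega> assume \<omega>: "\<omega> \<in> space P"
          let ?x' = "A \<omega> *v x + B \<omega>"
          show "indicator S \<omega> \<le> ennreal (indicator (E (Suc j)) ?x')
              + ennreal (1 / \<theta>) * ennreal (w ?x' - T' j)"
          proof (cases "\<omega> \<in> S")
            case S: True
            have "s * \<rho> ^ Suc j \<le> \<rho> * norm1 x"
              using True \<rho> by (simp add: E_def mult_ac)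
            also have "\<dots> \<le> norm1 ?x'"
              using expand[OF S x] norm1_step_ge[OF x \<omega>] by linarith
            finally have n: "s * \<rho> ^ Suc j \<le> norm1 ?x'" .
            show ?thesis
            proof (cases "w ?x' \<le> T' (Suc j)")
              case True
              with n step_orthant[OF x \<omega>] have "?x' \<in> E (Suc j)" by (simp add: E_def)
              then show ?thesis by (simp add: indicator_def)
            next
              case False
              then have "\<theta> \<le> w ?x' - T' j" by (simp add: T'_def algebra_simps)
              then have "1 \<le> 1 / \<theta> * (w ?x' - T' j)" using \<theta> by (simp add: field_simps)
              then have "1 \<le> ennreal (1 / \<theta>) * ennreal (w ?x' - T' j)"
                using \<theta> by (simp add: ennreal_mult''[symmetric] ennreal_mult'[symmetric] ennreal_ge_1)
              then show ?thesis using S by (simp add: add_increasing)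
            qed
          qed simp
        qed
        also have "\<dots> = ?F x + ennreal (1 / \<theta>) * (\<integral>\<^sup>+\<omega>. ennreal (w (A \<omega> *v x + B \<omega>) - T' j) \<partial>P)"
          by (subst nn_integral_add, measurable, subst nn_integral_cmult, measurable)
        finally show ?thesis using True by (simp add: E_def)
      qed simp
      have inv: "(\<integral>\<^sup>+x. ?F x \<partial>\<nu>) = emeasure \<nu> (E (Suc j))"
      proof -
        have "(\<integral>\<^sup>+x. ?F x \<partial>\<nu>) = (\<integral>\<^sup>+x. ennreal (indicator (E (Suc j)) x) \<partial>\<nu>)"
        proof (rule invariance(1)[where c = 1 and r = "exp (T' (Suc j))"])
          fix x :: "real ^ 'n" assume "x \<in> nonneg_orthant" "exp (T' (Suc j)) < norm1 x"
          then have "x \<notin> E (Suc j)" using w_le_imp_norm1_le[of x "T' (Suc j)"] by (auto simp: E_def)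
          then show "indicator (E (Suc j)) x = (0 :: real)" by simp
        qed (auto simp: indicator_def)
        also have "\<dots> = emeasure \<nu> (E (Suc j))"
          using E_nu by (simp add: ennreal_indicator)
        finally show ?thesis .
      qed
      have "ennreal q * emeasure \<nu> (E j) = (\<integral>\<^sup>+x. ennreal q * indicator (E j) x \<partial>\<nu>)"
        using E_nu by (simp add: nn_integral_cmult_indicator)
      also have "\<dots> \<le> (\<integral>\<^sup>+x. ?F x + ennreal (1 / \<theta>) * ?X x \<partial>\<nu>)"
        by (intro nn_integral_mono pt) simp
      also have "\<dots> = (\<integral>\<^sup>+x. ?F x \<partial>\<nu>) + ennreal (1 / \<theta>) * (\<integral>\<^sup>+x. ?X x \<partial>\<nu>)"
        by (subst nn_integral_add, measurable, subst nn_integral_cmult, measurable)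
      also have "\<dots> \<le> emeasure \<nu> (E (Suc j)) + ennreal (1 / \<theta>) * ennreal G"
        unfolding inv using upward_flux_bound[OF T'0[of j]] unfolding G(1)
        by (intro add_left_mono mult_left_mono) auto
      also have "ennreal (1 / \<theta>) * ennreal G = ennreal (G / \<theta>)"
        using \<theta> G by (simp add: ennreal_mult'[symmetric])
      finally show ?thesis .
    qed
    have "i \<le> J \<Longrightarrow> emeasure \<nu> (E (J - i)) \<le> ennreal (k i)" for i
    proof (induction i)
      case 0
      then show ?case by (simp add: E_empty)
    next
      case (Suc i)
      then have "Suc (J - Suc i) = J - i" by simp
      with step[of "J - Suc i"] have "ennreal q * emeasure \<nu> (E (J - Suc i)) \<le> ennreal (k i) + ennreal (G / \<theta>)"
        using Suc by (auto intro: order_trans add_right_mono)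
      also have "\<dots> = ennreal (q * k (Suc i))"
        using q k0[of i] G \<theta> by (simp add: k_Suc ennreal_plus[symmetric] del: ennreal_plus)
      also have "\<dots> = ennreal q * ennreal (k (Suc i))"
        using q by (simp add: ennreal_mult')
      finally show ?case
        using q by (simp add: ennreal_mult_le_mult_iff)
    qed
    from this[of J] show ?thesis by (simp add: E_def T'_def)
  qed
  then show ?thesis using k0 by blast
qed

end

text \<open>With \<open>r = b / a\<close> the shells at \<open>t = r\<^sup>k\<close> cover everything outside the ball of radius \<open>a\<close>. Slow
variation gives \<open>L (r\<^bsup>k+1\<^esup>) / L (r\<^sup>k) \<longlonglongrightarrow> 1\<close>, hence geometric decay of the weighted shell masses.\<close>

lemma norm1_powr_integrable:
  fixes L :: "real \<Rightarrow> real"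
  assumes sv: "slowly_varying L" and ab: "0 < a" "a < b" and c: "0 < c" and \<epsilon>: "0 < \<epsilon>"
    and bound: "\<And>t. 1 \<le> t \<Longrightarrow>
      emeasure \<nu> {x \<in> nonneg_orthant. norm1 x \<in> {t * a..t * b}} \<le> ennreal (c * L t)"
  shows "(\<integral>\<^sup>+x. ennreal ((1 + norm1 x) powr (- \<epsilon>)) \<partial>\<nu>) < \<infinity>"
proof -
  define r where "r = b / a"
  have r: "1 < r" "b = r * a" using ab by (auto simp: r_def)
  have rk: "1 \<le> r ^ k" for k using r by simp
  have L_pos: "0 < L (r ^ k)" for k using sv rk by (auto simp: slowly_varying_def)
  define u where "u k = c * L (r ^ k) * (a * r ^ k) powr (- \<epsilon>)" for k
  have u0: "0 \<le> u k" for k using c L_pos[of k] by (simp add: u_def)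
  have "summable u"
  proof -
    have "((\<lambda>t. L (t * r) / L t) \<longlongrightarrow> 1) at_top"
      using sv r by (simp add: slowly_varying_def)
    moreover have "filterlim (\<lambda>k. r ^ k) at_top sequentially"
      using r(1) filterlim_realpow_sequentially_gt1[of r]
      by (intro filterlim_at_infinity_imp_filterlim_at_top) auto
    ultimately have "(\<lambda>k. L (r ^ k * r) / L (r ^ k)) \<longlonglongrightarrow> 1"
      by (rule filterlim_compose)
    moreover have "1 < r powr (\<epsilon> / 2)" using r \<epsilon> by (simp add: gr_one_powr)
    ultimately have "eventually (\<lambda>k. L (r ^ k * r) / L (r ^ k) < r powr (\<epsilon> / 2)) sequentially"
      by (rule order_tendstoD)
    then obtain N where N: "\<And>k. k \<ge> N \<Longrightarrow> L (r ^ k * r) / L (r ^ k) < r powr (\<epsilon> / 2)"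
      by (auto simp: eventually_sequentially)
    show ?thesis
    proof (rule summable_ratio_test)
      show "r powr (- \<epsilon> / 2) < 1" using r \<epsilon> by (simp add: powr_less_one)
      fix k assume "N \<le> k"
      from N[OF this] have "L (r ^ Suc k) \<le> r powr (\<epsilon> / 2) * L (r ^ k)"
        using L_pos[of k] by (simp add: divide_less_eq mult.commute)
      then have "u (Suc k) \<le> c * (r powr (\<epsilon> / 2) * L (r ^ k)) * (a * r ^ Suc k) powr (- \<epsilon>)"
        unfolding u_def using c by (intro mult_right_mono mult_left_mono) auto
      also have "(a * r ^ Suc k) powr (- \<epsilon>) = (a * r ^ k) powr (- \<epsilon>) * r powr (- \<epsilon>)"
        using ab r by (simp add: powr_mult)
      also have "c * (r powr (\<epsilon> / 2) * L (r ^ k)) * ((a * r ^ k) powr (- \<epsilon>) * r powr (- \<epsilon>))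
          = (r powr (\<epsilon> / 2) * r powr (- \<epsilon>)) * u k"
        by (simp add: u_def mult_ac)
      also have "r powr (\<epsilon> / 2) * r powr (- \<epsilon>) = r powr (- \<epsilon> / 2)"
        by (simp add: powr_add[symmetric])
      finally show "norm (u (Suc k)) \<le> r powr (- \<epsilon> / 2) * norm (u k)"
        using u0 by simp
    qed
  qed
  let ?R = "\<lambda>k. {x \<in> nonneg_orthant. norm1 (x :: real ^ 'n) \<in> {r ^ k * a..r ^ k * b}}"
  let ?K = "{x \<in> nonneg_orthant. norm1 (x :: real ^ 'n) \<le> a}"
  have sets: "?R k \<in> sets \<nu>" "?K \<in> sets \<nu>" for k
    by (rule sets_nu_Collect; measurable)+
  let ?S = "\<lambda>x. \<Sum>k. ennreal ((a * r ^ k) powr (- \<epsilon>)) * indicator (?R k) x"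
  have pt: "ennreal ((1 + norm1 x) powr (- \<epsilon>)) \<le> indicator ?K x + ?S x"
    if x: "x \<in> nonneg_orthant" for x
  proof (cases "norm1 x \<le> a")
    case True
    have "(1 + norm1 x) powr (- \<epsilon>) \<le> 1"
      using \<epsilon> norm1_nonneg[of x] by (simp add: powr_minus inverse_le_1_iff ge_one_powr_ge_zero)
    then have "ennreal ((1 + norm1 x) powr (- \<epsilon>)) \<le> indicator ?K x"
      using True x by (simp add: ennreal_le_1)
    then show ?thesis by (simp add: add_increasing2)
  next
    case False
    \<comment> \<open>the least power of \<open>r\<close> that reaches \<open>|x|\<close>; its predecessor indexes a shell that contains \<open>x\<close>\<close>
    define m where "m = (LEAST n. norm1 x \<le> a * r ^ n)"
    obtain n where "norm1 x / a < r ^ n" using real_arch_pow[OF r(1)] by blast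
    then have "norm1 x \<le> a * r ^ n" using ab by (simp add: field_simps)
    then have m: "norm1 x \<le> a * r ^ m" unfolding m_def by (rule LeastI)
    with False have "m \<noteq> 0" by (cases m) auto
    then obtain k where k: "m = Suc k" by (cases m) auto
    have "\<not> norm1 x \<le> a * r ^ k"
      using not_less_Least[of k "\<lambda>n. norm1 x \<le> a * r ^ n"] k by (simp add: m_def)
    then have xR: "x \<in> ?R k" using m x k r by (simp add: mult_ac)
    have "(1 + norm1 x) powr (- \<epsilon>) \<le> (a * r ^ k) powr (- \<epsilon>)"
      using xR ab r \<epsilon> by (intro powr_mono2') (auto simp: mult_ac)
    then have "ennreal ((1 + norm1 x) powr (- \<epsilon>)) \<le> ennreal ((a * r ^ k) powr (- \<epsilon>)) * indicator (?R k) x"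
      using xR by (simp add: ennreal_leI)
    also have "\<dots> \<le> ?S x"
      using sum_le_suminf[OF summableI, of "{k}" "\<lambda>k. ennreal ((a * r ^ k) powr (- \<epsilon>)) * indicator (?R k) x"]
      by (simp only: finite.intros sum.insert sum.empty empty_iff zero_le add_0_right not_False_eq_True simp_thms)
    finally show ?thesis by (simp add: add_increasing)
  qed
  have "(\<integral>\<^sup>+x. ennreal ((1 + norm1 x) powr (- \<epsilon>)) \<partial>\<nu>) \<le> (\<integral>\<^sup>+x. indicator ?K x + ?S x \<partial>\<nu>)"
    by (intro nn_integral_mono pt) simp
  also have "\<dots> = emeasure \<nu> ?K + (\<Sum>k. ennreal ((a * r ^ k) powr (- \<epsilon>)) * emeasure \<nu> (?R k))"
  proof -
    have m: "(\<lambda>x. indicator ?K x :: ennreal) \<in> borel_measurable \<nu>"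
      "(\<lambda>x. ennreal ((a * r ^ k) powr (- \<epsilon>)) * indicator (?R k) x) \<in> borel_measurable \<nu>" for k
      by (intro borel_measurable_times_ennreal borel_measurable_indicator borel_measurable_const sets)+
    show ?thesis
      by (subst nn_integral_add[OF m(1) borel_measurable_suminf_order[OF m(2)]],
          subst nn_integral_suminf[OF m(2)],
          subst nn_integral_indicator[OF sets(2)],
          subst nn_integral_cmult_indicator[OF sets(1)], rule refl)
  qed
  also have "\<dots> \<le> emeasure \<nu> ?K + (\<Sum>k. ennreal (u k))"
  proof (intro add_left_mono suminf_le summableI)
    fix k
    have "ennreal ((a * r ^ k) powr (- \<epsilon>)) * emeasure \<nu> (?R k)
        \<le> ennreal ((a * r ^ k) powr (- \<epsilon>)) * ennreal (c * L (r ^ k))"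
      by (intro mult_left_mono bound rk) simp
    also have "\<dots> = ennreal ((a * r ^ k) powr (- \<epsilon>) * (c * L (r ^ k)))"
      by (rule ennreal_mult'[symmetric]) simp
    also have "\<dots> = ennreal (u k)"
      by (simp add: u_def mult_ac)
    finally show "ennreal ((a * r ^ k) powr (- \<epsilon>)) * emeasure \<nu> (?R k) \<le> ennreal (u k)" .
  qed
  also have "\<dots> < \<infinity>"
    using nu_ball_finite[of a] suminf_ennreal2[OF u0 \<open>summable u\<close>] by (simp add: ennreal_add_eq_top less_top)
  finally show ?thesis .
qed

end

section \<open>Support of the matrix law and elementary moment bounds\<close>

text \<open>The complement of the support is a union of open null sets, and by the Lindelof property countably
many of them suffice.\<close>

lemma AE_mat_support:
  fixes A :: "'w \<Rightarrow> real ^ 'n ^ 'n"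
  assumes A: "A \<in> borel_measurable P" and al: "AE \<omega> in P. allowable (A \<omega>)"
  shows "AE \<omega> in P. A \<omega> \<in> mat_support (distr P borel A)"
proof -
  let ?\<mu> = "distr P borel A"
  define F where "F = {U. open U \<and> emeasure ?\<mu> U = 0}"
  have "openin (top_of_set UNIV) U" if "U \<in> F" for U using that by (simp add: F_def)
  then obtain F' where F': "F' \<subseteq> F" "countable F'" "\<Union>F' = \<Union>F"
    using Lindelof_openin[of F UNIV] by metis
  have "(\<Union>U\<in>F'. U) \<in> null_sets ?\<mu>"
    using F' by (intro null_sets_UN') (auto simp: F_def null_sets_def)
  then have "\<Union>F \<in> null_sets ?\<mu>" using F'(3) by simp
  then have "AE g in ?\<mu>. g \<notin> \<Union>F" by (rule AE_not_in)
  from AE_distrD[OF A this] al show ?thesis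
  proof eventually_elim
    case (elim \<omega>)
    then show ?case
      by (auto simp: mat_support_def allowable_mats_def F_def zero_less_iff_neq_zero)
  qed
qed

lemma comparable_of_entry_ratio:
  fixes g :: "real ^ 'n ^ 'n"
  assumes pos: "g \<in> positive_mats" and ratio: "Max (mat_entries g) / Min (mat_entries g) \<le> \<kappa>"
    and \<kappa>: "0 < \<kappa>"
  shows "entries_comparable \<kappa> g"
proof -
  have "mat_entries g = (\<lambda>(i, j). g $ i $ j) ` UNIV"
    by (auto simp: mat_entries_def)
  then have fin: "finite (mat_entries g)" and ne: "mat_entries g \<noteq> {}" by simp_all
  have mem: "g $ i $ j \<in> mat_entries g" for i j by (auto simp: mat_entries_def)
  have "Min (mat_entries g) \<in> mat_entries g" by (rule Min_in[OF fin ne])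
  then have "0 < Min (mat_entries g)" using pos by (auto simp: mat_entries_def positive_mats_def)
  with ratio have le: "Max (mat_entries g) \<le> \<kappa> * Min (mat_entries g)" by (simp add: divide_le_eq)
  have "g $ i $ j \<le> \<kappa> * g $ k $ l" for i j k l
  proof -
    have "g $ i $ j \<le> Max (mat_entries g)" by (rule Max_ge[OF fin mem])
    also note le
    also have "\<kappa> * Min (mat_entries g) \<le> \<kappa> * g $ k $ l"
      using \<kappa> by (intro mult_left_mono Min_le[OF fin mem]) simp
    finally show ?thesis .
  qed
  with pos show ?thesis by (simp add: entries_comparable_def positive_mats_def)
qed

lemma ln_power_le_powr:
  fixes y \<delta> :: real
  assumes "1 \<le> y" "0 < \<delta>"
  shows "ln y \<le> y powr \<delta> / \<delta>" "(ln y)\<^sup>2 \<le> (2 / \<delta>)\<^sup>2 * y powr \<delta>"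
proof -
  show "ln y \<le> y powr \<delta> / \<delta>" by (rule ln_powr_bound[OF assms])
  have "ln y \<le> y powr (\<delta> / 2) / (\<delta> / 2)" using assms by (intro ln_powr_bound) auto
  then have "(ln y)\<^sup>2 \<le> (y powr (\<delta> / 2) / (\<delta> / 2))\<^sup>2"
    using assms by (intro power_mono) auto
  also have "\<dots> = (2 / \<delta>)\<^sup>2 * (y powr (\<delta> / 2) * y powr (\<delta> / 2))"
    by (simp add: power2_eq_square)
  also have "y powr (\<delta> / 2) * y powr (\<delta> / 2) = y powr \<delta>"
    by (simp add: powr_add[symmetric])
  finally show "(ln y)\<^sup>2 \<le> (2 / \<delta>)\<^sup>2 * y powr \<delta>" .
qed

text \<open>Separates the two factors, so that no joint moment of \<open>A\<close> and \<open>B\<close> is required.\<close>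

lemma mult_powr_le_add_powr:
  fixes d m \<delta> \<epsilon> :: real
  assumes d: "1 \<le> d" and m: "0 \<le> m" and \<epsilon>: "0 < \<epsilon>" "2 * \<epsilon> \<le> \<delta>"
  shows "(d * (1 + m)) powr \<epsilon> \<le> d powr \<delta> + 2 powr \<delta> * (1 + m powr \<delta>)"
proof -
  let ?u = "d powr \<epsilon>" and ?v = "(1 + m) powr \<epsilon>"
  have "0 \<le> (?u - ?v)\<^sup>2" by simp
  then have "2 * (?u * ?v) \<le> ?u\<^sup>2 + ?v\<^sup>2" by (simp add: power2_diff)
  moreover have "0 \<le> ?u * ?v" by simp
  ultimately have "?u * ?v \<le> ?u\<^sup>2 + ?v\<^sup>2" by linarith
  also have "?u\<^sup>2 = d powr (2 * \<epsilon>)"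
    by (simp add: power2_eq_square powr_add[symmetric])
  also have "?v\<^sup>2 = (1 + m) powr (2 * \<epsilon>)"
    by (simp add: power2_eq_square powr_add[symmetric])
  also have "d powr (2 * \<epsilon>) \<le> d powr \<delta>" using d \<epsilon> by (intro powr_mono) auto
  also have "(1 + m) powr (2 * \<epsilon>) \<le> 2 powr \<delta> * (1 + m powr \<delta>)"
  proof -
    have "(1 + m) powr (2 * \<epsilon>) \<le> (1 + m) powr \<delta>" using m \<epsilon> by (intro powr_mono) auto
    also have "\<dots> \<le> (2 * max 1 m) powr \<delta>" using m \<epsilon> by (intro powr_mono2) auto
    also have "\<dots> = 2 powr \<delta> * max 1 m powr \<delta>" by (simp add: powr_mult)
    also have "max 1 m powr \<delta> \<le> 1 + m powr \<delta>" by (simp add: max_def)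
    finally show ?thesis by simp
  qed
  finally show ?thesis using d m by (simp add: powr_mult)
qed

section \<open>Boundedness of the slowly varying factor\<close>

theorem proposition4p3:
  fixes P :: "'w measure"
    and A :: "'w \<Rightarrow> real ^ 'n ^ 'n" and B :: "'w \<Rightarrow> real ^ 'n"
    and As :: "nat \<Rightarrow> 'w \<Rightarrow> real ^ 'n ^ 'n" and Bs :: "nat \<Rightarrow> 'w \<Rightarrow> real ^ 'n"
    and \<Gamma> supp :: "(real ^ 'n ^ 'n) set"
    and \<delta> \<kappa> a b c :: real
    and \<nu> :: "(real ^ 'n) measure"
    and L :: "real \<Rightarrow> real"
  assumes prob: "prob_space P"
    and A_rv: "A \<in> borel_measurable P" and B_rv: "B \<in> borel_measurable P"
    and A_vals: "\<forall>\<omega>\<in>space P. A \<omega> \<in> allowable_mats"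
    and B_vals: "\<forall>\<omega>\<in>space P. B \<omega> \<in> nonneg_orthant"
    and indep: "prob_space.indep_vars P (\<lambda>_. borel) (\<lambda>n \<omega>. (As n \<omega>, Bs n \<omega>)) {1..}"
    and ident: "\<forall>n\<ge>1. distr P borel (\<lambda>\<omega>. (As n \<omega>, Bs n \<omega>)) = distr P borel (\<lambda>\<omega>. (A \<omega>, B \<omega>))"
    and supp_def: "supp = mat_support (distr P borel A)"
    and Gamma_def: "\<Gamma> = generated_semigroup supp"
    and Gamma_allowable: "\<forall>g\<in>\<Gamma>. allowable g"
    and Gamma_positive: "\<Gamma> \<inter> positive_mats \<noteq> {}"
    and delta_pos: "\<delta> > 0"
    and moment_A: "(\<integral>\<^sup>+\<omega>. ennreal (mat_N (A \<omega>) powr \<delta>) \<partial>P) < \<infinity>"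
    and expanding: "measure P {\<omega>\<in>space P. mat_iota (A \<omega>) \<ge> 1 + \<delta>} > 0"
    and moment_B: "(\<integral>\<^sup>+\<omega>. ennreal (norm1 (B \<omega>) powr \<delta>) \<partial>P) < \<infinity>"
    \<comment> \<open>the inverse is taken in \<^typ>\<open>ennreal\<close>, so that it is infinite where B vanishes\<close>
    and neg_moment_B: "(\<integral>\<^sup>+\<omega>. inverse (ennreal (norm1 (B \<omega>) powr \<delta>)) \<partial>P) < \<infinity>"
    and nonlattice:
      "closure (group_closure ((\<lambda>g. ln (spectral_radius g)) ` (\<Gamma> \<inter> positive_mats))) = UNIV"
    and lyapunov:
      "AE \<omega> in P. (\<lambda>n. ln (mat_norm (left_prod (\<lambda>k. As k \<omega>) n)) / real n) \<longlonglongrightarrow> 0"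
    and kappa_gt_1: "\<kappa> > 1"
    and supp_positive: "supp \<subseteq> positive_mats"
    and kappa_bound: "\<forall>g\<in>supp. Max (mat_entries g) / Min (mat_entries g) \<le> \<kappa>"
    and no_invariant_affine:
      "\<not> (\<exists>W. affine W \<and> (\<exists>x\<in>W \<inter> nonneg_orthant. x \<noteq> 0) \<and> bounded (W \<inter> nonneg_orthant) \<and>
            (\<forall>g\<in>supp. \<forall>x\<in>W \<inter> nonneg_orthant. g *v x \<in> W \<inter> nonneg_orthant))"
    and nu_radon: "radon_measure_on nonneg_orthant \<nu>"
    and nu_nonzero: "emeasure \<nu> (space \<nu>) \<noteq> 0"
    and nu_invariant: "invariant_measure P A B \<nu>"
    and L_slowly_varying: "slowly_varying L"
    and constants: "0 < a" "a < b" "0 < c"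
    and L_bounds:
      "\<forall>t\<ge>1.
        ennreal (L t) \<le> emeasure \<nu> {x\<in>nonneg_orthant. norm1 x \<in> {t * a..t * b}} \<and>
        emeasure \<nu> {x\<in>nonneg_orthant. norm1 x \<in> {t * a..t * b}} \<le> ennreal (c * L t)"
  shows "bounded (L ` {1..})"
proof -
  interpret P: prob_space P by (rule prob)
  have A_al: "\<And>\<omega>. \<omega> \<in> space P \<Longrightarrow> allowable (A \<omega>)"
    using A_vals by (simp add: allowable_mats_def)
  have B_or: "\<And>\<omega>. \<omega> \<in> space P \<Longrightarrow> B \<omega> \<in> nonneg_orthant" using B_vals by blast
  interpret affine_recursion P A B \<nu>
    by unfold_locales (use A_rv B_rv A_al B_or nu_radon nu_invariant in auto)
  note [measurable] = A_rv B_rv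
  have dist1: "1 \<le> distortion (A \<omega>)" if "\<omega> \<in> space P" for \<omega>
    by (rule distortion_terms(3)[OF colsum_pos_allowable[OF A_al[OF that]]])

  have dist_moment: "integrable P (\<lambda>\<omega>. distortion (A \<omega>) powr \<delta>)"
  proof -
    define C where "C = (2 * real CARD('n)) powr \<delta>"
    have C: "0 < C" by (simp add: C_def)
    have le: "distortion (A \<omega>) powr \<delta> / C \<le> mat_N (A \<omega>) powr \<delta>" if "\<omega> \<in> space P" for \<omega>
    proof -
      have d: "distortion (A \<omega>) \<le> 2 * real CARD('n) * mat_N (A \<omega>)"
        by (rule distortion_le_mat_N[OF A_al[OF that]])
      with dist1[OF that] have "0 < 2 * real CARD('n) * mat_N (A \<omega>)" by linarith
      then have N0: "0 \<le> mat_N (A \<omega>)" by (simp add: zero_less_mult_iff)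
      have "distortion (A \<omega>) powr \<delta> \<le> (2 * real CARD('n) * mat_N (A \<omega>)) powr \<delta>"
        using d dist1[OF that] delta_pos by (intro powr_mono2) auto
      also have "\<dots> = C * mat_N (A \<omega>) powr \<delta>" using N0 by (simp add: C_def powr_mult)
      finally show ?thesis using C by (simp add: divide_le_eq mult.commute)
    qed
    have "(\<integral>\<^sup>+\<omega>. ennreal (distortion (A \<omega>) powr \<delta> / C) \<partial>P) \<le> (\<integral>\<^sup>+\<omega>. ennreal (mat_N (A \<omega>) powr \<delta>) \<partial>P)"
      by (intro nn_integral_mono ennreal_leI le)
    also note moment_A
    finally have "integrable P (\<lambda>\<omega>. distortion (A \<omega>) powr \<delta> / C)"
      using C by (intro integrableI_nonneg) auto
    then have "integrable P (\<lambda>\<omega>. C * (distortion (A \<omega>) powr \<delta> / C))" by (rule integrable_mult_right)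
    then show ?thesis using C by simp
  qed
  have B_moment: "integrable P (\<lambda>\<omega>. norm1 (B \<omega>) powr \<delta>)"
    using moment_B by (intro integrableI_nonneg) auto

  let ?\<mu> = "distr P borel A"
  have comparable_A: "AE \<omega> in P. entries_comparable \<kappa> (A \<omega>)"
  proof -
    have "AE \<omega> in P. A \<omega> \<in> supp"
      unfolding supp_def using A_al by (intro AE_mat_support A_rv AE_I2) auto
    then show ?thesis
    proof eventually_elim
      case (elim \<omega>)
      with supp_positive kappa_bound kappa_gt_1 show ?case
        by (intro comparable_of_entry_ratio) auto
    qed
  qed
  interpret law: comparable_matrix_law ?\<mu> \<kappa>
  proof (intro comparable_matrix_law.intro comparable_matrix_law_axioms.intro)
    show "prob_space ?\<mu>" by (rule P.prob_space_distr) (rule A_rv)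
    show "sets ?\<mu> = sets borel" by simp
    have entry [measurable]: "(\<lambda>g :: real ^ 'n ^ 'n. g $ i $ j) \<in> borel_measurable borel" for i j
      by (intro borel_measurable_continuous_onI continuous_intros)
    have "Measurable.pred borel (entries_comparable \<kappa> :: real ^ 'n ^ 'n \<Rightarrow> bool)"
      unfolding entries_comparable_def[abs_def] by measurable
    with comparable_A show "AE g in ?\<mu>. entries_comparable \<kappa> g"
      by (subst AE_distr_iff) (auto simp: A_rv)
    have "integrable P (\<lambda>\<omega>. ln (distortion (A \<omega>)))"
    proof (rule Bochner_Integration.integrable_bound)
      show "integrable P (\<lambda>\<omega>. distortion (A \<omega>) powr \<delta> / \<delta>)" using dist_moment by simp
      show "AE \<omega> in P. norm (ln (distortion (A \<omega>))) \<le> norm (distortion (A \<omega>) powr \<delta> / \<delta>)"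
        using ln_power_le_powr(1)[OF dist1 delta_pos] dist1 delta_pos by (intro AE_I2) simp
    qed measurable
    then show "integrable ?\<mu> (\<lambda>g. ln (distortion g))"
      by (subst integrable_distr_eq) auto
  qed

  have lyap: "\<bar>law.log_growth n x - ln (norm1 x)\<bar> \<le> ln \<kappa>" if "x \<in> nonzero_orthant" for n x
  proof (rule law.log_growth_bounded[OF _ _ that])
    show "(\<chi> i. 1) \<in> nonzero_orthant" by (auto simp: nonneg_orthant_def vec_eq_iff)
    show "(\<lambda>n. law.log_growth n (\<chi> i. 1) / real n) \<longlonglongrightarrow> 0"
    proof (rule law.log_growth_sublinear[OF prob])
      show "P.indep_vars (\<lambda>_. borel) As {1..}"
        using P.indep_vars_compose2[OF indep, of "\<lambda>_. fst" "\<lambda>_. borel"] by (simp add: borel_prod[symmetric])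
      have meas: "(\<lambda>\<omega>. (As k \<omega>, Bs k \<omega>)) \<in> borel_measurable P" if "1 \<le> k" for k
        using indep that unfolding P.indep_vars_def by auto
      have fst_meas: "(fst :: (real ^ 'n ^ 'n) \<times> (real ^ 'n) \<Rightarrow> _) \<in> borel_measurable borel"
        by (intro borel_measurable_continuous_onI continuous_intros)
      show "distr P borel (As k) = ?\<mu>" if k: "1 \<le> k" for k
      proof -
        have AB: "(\<lambda>\<omega>. (A \<omega>, B \<omega>)) \<in> borel_measurable P" by measurable
        have "distr P borel (As k) = distr (distr P borel (\<lambda>\<omega>. (As k \<omega>, Bs k \<omega>))) borel fst"
          by (simp add: distr_distr[OF fst_meas meas[OF k]] o_def)
        also have "\<dots> = distr (distr P borel (\<lambda>\<omega>. (A \<omega>, B \<omega>))) borel fst"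
          using ident k by simp
        also have "\<dots> = ?\<mu>"
          by (simp add: distr_distr[OF fst_meas AB] o_def)
        finally show ?thesis .
      qed
      have "integrable P (\<lambda>\<omega>. (ln (distortion (A \<omega>)))\<^sup>2)"
      proof (rule Bochner_Integration.integrable_bound)
        show "integrable P (\<lambda>\<omega>. (2 / \<delta>)\<^sup>2 * distortion (A \<omega>) powr \<delta>)" using dist_moment by simp
        show "AE \<omega> in P. norm ((ln (distortion (A \<omega>)))\<^sup>2) \<le> norm ((2 / \<delta>)\<^sup>2 * distortion (A \<omega>) powr \<delta>)"
          using ln_power_le_powr(2)[OF dist1 delta_pos] by (intro AE_I2) (simp add: abs_mult)
      qed measurable
      then show "integrable ?\<mu> (\<lambda>g. (ln (distortion g))\<^sup>2)"
        by (subst integrable_distr_eq) auto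
      show "AE \<omega> in P. (\<lambda>n. ln (mat_norm (left_prod (\<lambda>k. As k \<omega>) n)) / real n) \<longlonglongrightarrow> 0"
        by (rule lyapunov)
    qed
  qed

  \<comment> \<open>half of \<open>\<delta>\<close>, since the moment of a product of \<open>A\<close> and \<open>B\<close> terms is estimated by the sum of their squares\<close>
  define \<epsilon> where "\<epsilon> = min (\<delta> / 2) 1"
  have \<epsilon>: "0 < \<epsilon>" "\<epsilon> \<le> 1" "2 * \<epsilon> \<le> \<delta>" using delta_pos by (auto simp: \<epsilon>_def)
  have moment: "integrable P (\<lambda>\<omega>. (distortion (A \<omega>) * (1 + norm1 (B \<omega>))) powr \<epsilon>)"
  proof (rule Bochner_Integration.integrable_bound)
    show "integrable P (\<lambda>\<omega>. distortion (A \<omega>) powr \<delta> + 2 powr \<delta> * (1 + norm1 (B \<omega>) powr \<delta>))"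
      using dist_moment B_moment by simp
    show "AE \<omega> in P. norm ((distortion (A \<omega>) * (1 + norm1 (B \<omega>))) powr \<epsilon>)
        \<le> norm (distortion (A \<omega>) powr \<delta> + 2 powr \<delta> * (1 + norm1 (B \<omega>) powr \<delta>))"
    proof (rule AE_I2)
      fix \<omega> assume "\<omega> \<in> space P"
      from mult_powr_le_add_powr[OF dist1[OF this] norm1_nonneg \<epsilon>(1,3), of "B \<omega>"]
      show "norm ((distortion (A \<omega>) * (1 + norm1 (B \<omega>))) powr \<epsilon>)
          \<le> norm (distortion (A \<omega>) powr \<delta> + 2 powr \<delta> * (1 + norm1 (B \<omega>) powr \<delta>))"
        by (simp only: real_norm_def) (metis abs_ge_self abs_of_nonneg order_trans powr_ge_zero)
    qed
  qed measurable
  obtain w D where w: "w \<in> borel_measurable borel" and D: "0 \<le> D"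
    and w_lower: "\<And>x. x \<in> nonneg_orthant \<Longrightarrow> ln (1 + norm1 x) \<le> w x"
    and w_upper: "\<And>x. x \<in> nonneg_orthant \<Longrightarrow> w x \<le> ln (1 + norm1 x) + 2 * ln \<kappa>"
    and drift: "\<And>x. x \<in> nonneg_orthant \<Longrightarrow> (\<integral>\<^sup>+\<omega>. ennreal (w (A \<omega> *v x + B \<omega>)) \<partial>P)
        \<le> ennreal (w x + D * (1 + norm1 x) powr (- \<epsilon>))"
  proof (rule law.lyapunov_function[OF prob A_rv B_rv B_or refl lyap \<epsilon>(1,2) moment])
    fix w D
    assume "w \<in> borel_measurable borel" "0 \<le> D"
      "\<And>x. x \<in> nonneg_orthant \<Longrightarrow> ln (1 + norm1 x) \<le> w x"
      "\<And>x. x \<in> nonneg_orthant \<Longrightarrow> w x \<le> ln (1 + norm1 x) + 2 * ln \<kappa>"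
      "\<And>x. x \<in> nonneg_orthant \<Longrightarrow> (\<integral>\<^sup>+\<omega>. ennreal (w (A \<omega> *v x + B \<omega>)) \<partial>P)
        \<le> ennreal (w x + D * (1 + norm1 x) powr (- \<epsilon>))"
    then show thesis by (rule that)
  qed

  let ?h = "\<lambda>x :: real ^ 'n. D * (1 + norm1 x) powr (- \<epsilon>)"
  have h: "?h \<in> borel_measurable borel" by measurable
  have h0: "0 \<le> ?h x" for x using D by simp
  have h_finite: "(\<integral>\<^sup>+x. ennreal (?h x) \<partial>\<nu>) < \<infinity>"
  proof -
    have "(\<integral>\<^sup>+x. ennreal ((1 + norm1 x) powr (- \<epsilon>)) \<partial>\<nu>) < \<infinity>"
      using L_bounds by (intro norm1_powr_integrable[OF L_slowly_varying constants \<epsilon>(1)]) blast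
    moreover have "(\<lambda>x :: real ^ 'n. ennreal ((1 + norm1 x) powr (- \<epsilon>))) \<in> borel_measurable \<nu>"
      by (rule measurable_nu) measurable
    ultimately show ?thesis
      using D by (simp add: ennreal_mult' nn_integral_cmult ennreal_mult_less_top)
  qed

  define S where "S = {\<omega> \<in> space P. 1 + \<delta> \<le> mat_iota (A \<omega>)}"
  have S: "0 < P.prob S" using expanding by (simp add: S_def)
  then have S_ev: "S \<in> P.events" using measure_notin_sets[of S P] by fastforce
  have S_expand: "(1 + \<delta>) * norm1 x \<le> norm1 (A \<omega> *v x)"
    if "\<omega> \<in> S" "x \<in> nonneg_orthant" for \<omega> x
  proof -
    have \<omega>: "\<omega> \<in> space P" "1 + \<delta> \<le> mat_iota (A \<omega>)" using that(1) by (auto simp: S_def)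
    have "(1 + \<delta>) * norm1 x \<le> mat_iota (A \<omega>) * norm1 x" using \<omega>(2) by (intro mult_right_mono) auto
    also have "\<dots> \<le> norm1 (A \<omega> *v x)" by (rule mat_iota_bounds(3)[OF A_al[OF \<omega>(1)] that(2)])
    finally show ?thesis .
  qed
  \<comment> \<open>\<open>R\<close> bounds \<open>exp T / s\<close> for the levels \<open>T = ln (1 + t b) + 2 ln \<kappa>\<close> and \<open>s = t a\<close> that enclose the shell, for all \<open>t \<ge> 1\<close>\<close>
  define R where "R = \<kappa>\<^sup>2 * (1 + b) / a"
  obtain K where K: "0 \<le> K"
    "\<And>T s. 0 \<le> T \<Longrightarrow> 0 < s \<Longrightarrow> exp T \<le> R * s \<Longrightarrow>
      emeasure \<nu> {x \<in> nonneg_orthant. w x \<le> T \<and> s \<le> norm1 x} \<le> ennreal K"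
    using band_measure_bounded[OF w h h0 w_lower drift _ S_ev S S_expand h_finite, of R]
      delta_pos by auto

  have L_le: "L t \<le> K" if t: "1 \<le> t" for t
  proof -
    let ?T = "ln (1 + t * b) + 2 * ln \<kappa>"
    let ?R = "{x \<in> nonneg_orthant. norm1 (x :: real ^ 'n) \<in> {t * a..t * b}}"
    let ?E = "{x \<in> nonneg_orthant. w x \<le> ?T \<and> t * a \<le> norm1 x}"
    have tb: "0 < t * b" "0 < t * a" using t constants by simp_all
    have "ennreal (L t) \<le> emeasure \<nu> ?R" using L_bounds t by blast
    also have "\<dots> \<le> emeasure \<nu> ?E"
    proof (rule emeasure_mono)
      show "?R \<subseteq> ?E"
      proof safe
        fix x :: "real ^ 'n" assume x: "x \<in> nonneg_orthant" "norm1 x \<in> {t * a..t * b}"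
        have "w x \<le> ln (1 + norm1 x) + 2 * ln \<kappa>" by (rule w_upper[OF x(1)])
        also have "ln (1 + norm1 x) \<le> ln (1 + t * b)"
          using x(2) norm1_nonneg[of x] tb by (subst ln_le_cancel_iff) auto
        finally show "w x \<le> ?T" by simp
        show "t * a \<le> norm1 x" using x(2) by simp
      qed
      note [measurable] = w
      show "?E \<in> sets \<nu>" by (rule sets_nu_Collect) measurable
    qed
    also have "\<dots> \<le> ennreal K"
    proof (rule K(2))
      show "0 \<le> ?T" using tb kappa_gt_1 by (intro add_nonneg_nonneg) auto
      show "0 < t * a" by (rule tb)
      have "exp ?T = (1 + t * b) * \<kappa>\<^sup>2"
        using tb kappa_gt_1 by (simp add: exp_add exp_double)
      also have "\<dots> \<le> (t * (1 + b)) * \<kappa>\<^sup>2"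
        using t by (intro mult_right_mono) (auto simp: algebra_simps)
      also have "\<dots> = R * (t * a)" using constants by (simp add: R_def)
      finally show "exp ?T \<le> R * (t * a)" .
    qed
    finally show ?thesis using K(1) by (simp add: ennreal_le_iff)
  qed
  show ?thesis
  proof (rule boundedI)
    fix y assume "y \<in> L ` {1..}"
    then obtain t where t: "1 \<le> t" "y = L t" by auto
    with L_slowly_varying have "0 < L t" by (simp add: slowly_varying_def)
    with L_le[OF t(1)] t(2) show "norm y \<le> K" by simp
  qed
qed

end
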